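(* Let $\beta,\theta,s,\theta'\in k^\times$, $X^*=\beta\cdot\sqrt\theta$ and $Y=s\cdot\sqrt{\theta'}$. Then $$M^G_{X^*}(Y)=\tfrac12|s|^{-1/2}q^{-(r'+1)/2}\Bigl(\bigl(J^\theta_{\nu^{1/2}}(u,v)+\gamma_{\mathrm{un}}(s)J^\theta_{\nu^{1/2}\operatorname{sgn}_\epsilon}(u,v)\bigr)+\gamma_{\mathrm{ram}}(s)\bigl(J^\theta_{\nu^{1/2}\operatorname{sgn}_\varpi}(u,v)-\gamma_{\mathrm{un}}(s)J^\theta_{\nu^{1/2}\operatorname{sgn}_{\epsilon\varpi}}(u,v)\bigr)\Bigr).$$
   Context: $k$ is a non-discrete non-Archimedean local field of residual characteristic $\ne 2$, with ring of integers $\mathcal O$, maximal ideal $\mathfrak p$, valuation $\operatorname{ord}$ with value group $\mathbb Z$, residue field of order $q$, $|x|=q^{-\operatorname{ord}(x)}$, $\nu^\alpha(x)=|x|^\alpha$. $\epsilon\in\mathcal O^\times$ is a lift of a non-square of the residue field; $\varpi$ is a uniformiser. $dx$ (or $dt$) is the Haar measure on $k$ giving $\mathcal O$ measure $1$, and $d^\times x=|x|^{-1}dx$. $\Phi$ is a non-trivial additive character of $k$; $\Phi_b(x)=\Phi(bx)$; the depth of a non-trivial additive character $\Psi$ is $\min\{i\in\mathbb Z:\Psi$ trivial on $\mathfrak p^{i+1}\}$. For $\theta\in k^\times$, $k_\theta=k\oplus k\sqrt\theta$ is the $k$-algebra $k[x]/(x^2-\theta)$, $N_\theta(a+b\sqrt\theta)=a^2-b^2\theta$,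 and $\operatorname{sgn}_\theta$ is the $\{\pm1\}$-valued character of $k^\times$ with kernel $N_\theta(k_\theta^\times)$. In $\mathfrak g=\mathfrak{sl}_2(k)$, $\sqrt\theta$ denotes $\begin{pmatrix}0&1\\ \theta&0\end{pmatrix}$; $X^*=\beta\sqrt\theta$ is the functional $Z\mapsto\mathrm{Tr}(\beta\sqrt\theta Z)$ on $\mathfrak g$. Put $\Phi'=\Phi_\beta$, $r'=\operatorname{depth}(\Phi')$, $u=\varpi^{-(r'+1)}s\theta'$, $v=\varpi^{-(r'+1)}s\theta$, $\gamma_{\mathrm{un}}(s)=(-1)^{r'+1}\operatorname{sgn}_\epsilon(s)$, $\gamma_{\mathrm{ram}}(s)=\operatorname{sgn}_\varpi(-s)G_\varpi(\Phi')$, where $G_\varpi(\Psi)=q^{-1/2}\sum_{X\in\mathcal O/\mathfrak p}\Psi((-\varpi)^{\operatorname{depth}(\Psi)}X^2)$. Bessel functions, taken with respect to the depth-$(-1)$ additive character $\Phi'_{\varpi^{r'+1}}$: for a multiplicative (quasi-)character $\chi$ of $k^\times$, $$J_\chi(u,v)=\sum_{n\in\mathbb Z}\int_{\operatorname{ord}(x)=n}\Phi'_{\varpi^{r'+1}}(ux+vx^{-1})\chi(x)\,d^\times x,\qquad J^\theta_\chi=\tfrac12(J_\chi+J_{\chi\operatorname{sgn}_\theta}).$$ Mock Fourier transform: $$M^G_{X^*}(Y)=\sum_{n\in\mathbb Z}\int_{\operatorname{ord}(x)=n}\mathbf 1_{N_\theta(k_\theta^\times)}(x)\Bigl(\sum_{l\in\mathbb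 Z}\int_{\operatorname{ord}(t)=l}\Phi\bigl(\beta s(x\theta'+x^{-1}\theta-x^{-1}t^2)\bigr)\,dt\Bigr)d^\times x,$$ where $\mathbf 1_S$ is the characteristic function of $S$. *)

theory Defs
  imports "HOL-Analysis.Analysis"
begin

section \<open>Non-Archimedean local fields\<close>

text \<open>
  The valuation is normalised to have value group \<open>\<int>\<close>, so the field is automatically
  non-discrete. Only the values \<open>vord x\<close> with \<open>x \<noteq> 0\<close> are meaningful; \<open>vord 0\<close> (which should
  be \<open>\<infinity>\<close>) is an unspecified integer, and every use below is guarded accordingly.
\<close>

class nonarch_local_field = field + topological_space +
  fixes vord :: "'a \<Rightarrow> int"
  assumes vord_mult: "x \<noteq> 0 \<Longrightarrow> y \<noteq> 0 \<Longrightarrow> vord (x * y) = vord x + vord y"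
    and vord_add: "x \<noteq> 0 \<Longrightarrow> y \<noteq> 0 \<Longrightarrow> x + y \<noteq> 0 \<Longrightarrow> min (vord x) (vord y) \<le> vord (x + y)"
    and vord_surj: "\<exists>x. x \<noteq> 0 \<and> vord x = n"
    and open_iff_vord:
      "open U \<longleftrightarrow> (\<forall>x\<in>U. \<exists>n. \<forall>y. y \<noteq> x \<longrightarrow> n \<le> vord (y - x) \<longrightarrow> y \<in> U)"
    and locally_compact_field: "\<exists>U K. open U \<and> compact K \<and> x \<in> U \<and> U \<subseteq> K"

text \<open>\<open>ppow n\<close> is the fractional ideal \<open>\<pp>\<^sup>n\<close>, for an arbitrary integer \<open>n\<close>.\<close>

definition ppow :: "int \<Rightarrow> 'a::nonarch_local_field set" where
  "ppow n = {x. x = 0 \<or> n \<le> vord x}"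

abbreviation val_ring :: "'a::nonarch_local_field set" where
  "val_ring \<equiv> ppow 0"

abbreviation max_ideal :: "'a::nonarch_local_field set" where
  "max_ideal \<equiv> ppow 1"

definition shell :: "int \<Rightarrow> 'a::nonarch_local_field set" where
  "shell n = {x. x \<noteq> 0 \<and> vord x = n}"

definition residue_classes :: "'a::nonarch_local_field set set" where
  "residue_classes = val_ring // {(x, y). x \<in> val_ring \<and> y \<in> val_ring \<and> x - y \<in> max_ideal}"

definition residue_card :: "'a::nonarch_local_field itself \<Rightarrow> nat" where
  "residue_card _ = card (residue_classes :: 'a set set)"

text \<open>The residual characteristic differs from \<open>2\<close> iff \<open>1 + 1\<close> is non-zero in \<open>\<O>/\<pp>\<close>.\<close>

definition residual_char_not_2 :: "'a::nonarch_local_field itself \<Rightarrow> bool" where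
  "residual_char_not_2 _ \<longleftrightarrow> (2::'a) \<notin> max_ideal"

definition uniformiser :: "'a::nonarch_local_field \<Rightarrow> bool" where
  "uniformiser w \<longleftrightarrow> w \<noteq> 0 \<and> vord w = 1"

definition lifts_nonsquare :: "'a::nonarch_local_field \<Rightarrow> bool" where
  "lifts_nonsquare e \<longleftrightarrow> e \<in> shell 0 \<and> (\<forall>y\<in>val_ring. e - y\<^sup>2 \<notin> max_ideal)"

definition absv :: "'a::nonarch_local_field \<Rightarrow> real" where
  "absv x = (if x = 0 then 0 else real (residue_card TYPE('a)) powi (- vord x))"

definition nu :: "real \<Rightarrow> 'a::nonarch_local_field \<Rightarrow> complex" where
  "nu \<alpha> x = of_real (absv x powr \<alpha>)"

definition normalised_haar :: "'a::nonarch_local_field measure \<Rightarrow> bool" where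
  "normalised_haar \<mu> \<longleftrightarrow> sets \<mu> = sets borel \<and> (\<forall>a. distr \<mu> borel (\<lambda>x. a + x) = \<mu>) \<and>
     emeasure \<mu> val_ring = 1"

definition mult_haar :: "'a::nonarch_local_field measure \<Rightarrow> 'a measure" where
  "mult_haar \<mu> = density \<mu> (\<lambda>x. ennreal (inverse (absv x)))"


section \<open>Additive characters\<close>

definition additive_character :: "('a::nonarch_local_field \<Rightarrow> complex) \<Rightarrow> bool" where
  "additive_character \<Psi> \<longleftrightarrow> continuous_on UNIV \<Psi> \<and> (\<forall>x. norm (\<Psi> x) = 1) \<and>
     (\<forall>x y. \<Psi> (x + y) = \<Psi> x * \<Psi> y)"

definition nontrivial_additive_character :: "('a::nonarch_local_field \<Rightarrow> complex) \<Rightarrow> bool" where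
  "nontrivial_additive_character \<Psi> \<longleftrightarrow> additive_character \<Psi> \<and> (\<exists>x. \<Psi> x \<noteq> 1)"

definition scale_char :: "('a::nonarch_local_field \<Rightarrow> complex) \<Rightarrow> 'a \<Rightarrow> 'a \<Rightarrow> complex" where
  "scale_char \<Psi> b = (\<lambda>x. \<Psi> (b * x))"

definition depth :: "('a::nonarch_local_field \<Rightarrow> complex) \<Rightarrow> int" where
  "depth \<Psi> = (LEAST i. \<forall>x\<in>ppow (i + 1). \<Psi> x = 1)"

text \<open>
  The summand depends only on the residue class \<open>C\<close>, since \<open>\<Psi>\<close> is trivial on
  \<open>\<pp>\<close> to the power \<open>depth \<Psi> + 1\<close>; hence the arbitrary choice of a representative.
\<close>

definition gauss_sum :: "'a::nonarch_local_field \<Rightarrow> ('a \<Rightarrow> complex) \<Rightarrow> complex" where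
  "gauss_sum w \<Psi> = of_real (real (residue_card TYPE('a)) powr (- 1 / 2)) *
     (\<Sum>C\<in>residue_classes. \<Psi> ((- w) powi depth \<Psi> * (SOME X. X \<in> C)\<^sup>2))"


section \<open>Quadratic extensions and their sign characters\<close>

text \<open>
  The pair \<open>(a, b)\<close> stands for \<open>a + b\<surd>\<theta>\<close> in \<open>k[x]/(x\<^sup>2 - \<theta>)\<close>, which is not a field
  when \<open>\<theta>\<close> is a square.
\<close>

definition quad_mult :: "'a::nonarch_local_field \<Rightarrow> 'a \<times> 'a \<Rightarrow> 'a \<times> 'a \<Rightarrow> 'a \<times> 'a" where
  "quad_mult \<theta> z w =
     (fst z * fst w + snd z * snd w * \<theta>, fst z * snd w + snd z * fst w)"

definition quad_units :: "'a::nonarch_local_field \<Rightarrow> ('a \<times> 'a) set" where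
  "quad_units \<theta> = {z. \<exists>w. quad_mult \<theta> z w = (1, 0)}"

definition quad_norm :: "'a::nonarch_local_field \<Rightarrow> 'a \<times> 'a \<Rightarrow> 'a" where
  "quad_norm \<theta> z = (fst z)\<^sup>2 - (snd z)\<^sup>2 * \<theta>"

definition norm_group :: "'a::nonarch_local_field \<Rightarrow> 'a set" where
  "norm_group \<theta> = quad_norm \<theta> ` quad_units \<theta>"

text \<open>
  A \<open>{\<plusminus>1}\<close>-valued character is determined by its kernel. Only values at non-zero arguments
  are meaningful.
\<close>

definition sgn_char :: "'a::nonarch_local_field \<Rightarrow> 'a \<Rightarrow> complex" where
  "sgn_char \<theta> x = (if x \<in> norm_group \<theta> then 1 else - 1)"

definition gamma_un :: "('a::nonarch_local_field \<Rightarrow> complex) \<Rightarrow> 'a \<Rightarrow> 'a \<Rightarrow> complex" where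
  "gamma_un \<Psi> \<epsilon> s = (- 1) powi (depth \<Psi> + 1) * sgn_char \<epsilon> s"

definition gamma_ram :: "('a::nonarch_local_field \<Rightarrow> complex) \<Rightarrow> 'a \<Rightarrow> 'a \<Rightarrow> complex" where
  "gamma_ram \<Psi> w s = sgn_char w (- s) * gauss_sum w \<Psi>"


section \<open>Bessel functions\<close>

text \<open>
  Sums over the shells are taken unconditionally over \<open>\<int>\<close> by \<open>infsum\<close>; for \<open>u, v \<noteq> 0\<close> all but
  finitely many terms of the Bessel sum vanish.
\<close>

definition bessel ::
  "'a::nonarch_local_field measure \<Rightarrow> ('a \<Rightarrow> complex) \<Rightarrow> ('a \<Rightarrow> complex) \<Rightarrow> 'a \<Rightarrow> 'a \<Rightarrow> complex"
  where
  "bessel \<mu> \<Psi> \<kappa> u v =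
     (\<Sum>\<^sub>\<infinity>n\<in>(UNIV::int set).
        (LINT x:(shell n)|(mult_haar \<mu>). \<Psi> (u * x + v * inverse x) * \<kappa> x))"

definition bessel_theta ::
  "'a::nonarch_local_field measure \<Rightarrow> ('a \<Rightarrow> complex) \<Rightarrow> 'a \<Rightarrow> ('a \<Rightarrow> complex) \<Rightarrow> 'a \<Rightarrow> 'a \<Rightarrow> complex"
  where
  "bessel_theta \<mu> \<Psi> \<theta> \<kappa> u v =
     1 / 2 * (bessel \<mu> \<Psi> \<kappa> u v + bessel \<mu> \<Psi> (\<lambda>x. \<kappa> x * sgn_char \<theta> x) u v)"


section \<open>The mock Fourier transform\<close>

definition sl2 :: "('a::nonarch_local_field ^ 2 ^ 2) set" where
  "sl2 = {Z. trace Z = 0}"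

definition sqrt_mat :: "'a::nonarch_local_field \<Rightarrow> 'a ^ 2 ^ 2" where
  "sqrt_mat \<theta> = vector [vector [0, 1], vector [\<theta>, 0]]"

definition trace_functional :: "'a::nonarch_local_field ^ 2 ^ 2 \<Rightarrow> ('a ^ 2 ^ 2 \<Rightarrow> 'a)" where
  "trace_functional A = (\<lambda>Z\<in>sl2. trace (A ** Z))"

definition mock_FT_integral ::
  "'a::nonarch_local_field measure \<Rightarrow> ('a \<Rightarrow> complex) \<Rightarrow> 'a \<Rightarrow> 'a \<Rightarrow> 'a \<Rightarrow> 'a \<Rightarrow> complex" where
  "mock_FT_integral \<mu> \<Phi> \<beta> \<theta> s \<theta>' =
     (\<Sum>\<^sub>\<infinity>n\<in>(UNIV::int set).
        (LINT x:(shell n)|(mult_haar \<mu>).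
           indicator (norm_group \<theta>) x *
           (\<Sum>\<^sub>\<infinity>l\<in>(UNIV::int set).
              (LINT t:(shell l)|\<mu>.
                 \<Phi> (\<beta> * s * (x * \<theta>' + inverse x * \<theta> - inverse x * t\<^sup>2))))))"

text \<open>
  For \<open>X = \<beta>\<surd>\<theta>\<close> (as a functional) and \<open>Y = s\<surd>\<theta>'\<close> the four parameters are determined by
  \<open>X\<close> and \<open>Y\<close>, so the description below is unique; see the lemma that follows.
\<close>

definition mock_FT ::
  "'a::nonarch_local_field measure \<Rightarrow> ('a \<Rightarrow> complex) \<Rightarrow> ('a ^ 2 ^ 2 \<Rightarrow> 'a) \<Rightarrow> 'a ^ 2 ^ 2 \<Rightarrow> complex"
  where
  "mock_FT \<mu> \<Phi> X Y =
     (THE z. \<exists>\<beta> \<theta> s \<theta>'. \<beta> \<noteq> 0 \<and> \<theta> \<noteq> 0 \<and> s \<noteq> 0 \<and> \<theta>' \<noteq> 0 \<and>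
        X = trace_functional (mat \<beta> ** sqrt_mat \<theta>) \<and> Y = mat s ** sqrt_mat \<theta>' \<and>
        z = mock_FT_integral \<mu> \<Phi> \<beta> \<theta> s \<theta>')"

lemma mat_times_sqrt_mat:
  "mat c ** sqrt_mat \<theta> = vector [vector [0, c], vector [c * \<theta>, 0]]"
  by (simp add: vec_eq_iff forall_2 matrix_matrix_mult_def sum_2 mat_def sqrt_mat_def)

lemma trace_functional_entries:
  shows "trace_functional (mat \<beta> ** sqrt_mat \<theta>) (vector [vector [0, 0], vector [1, 0]]) = \<beta>"
    and "trace_functional (mat \<beta> ** sqrt_mat \<theta>) (vector [vector [0, 1], vector [0, 0]]) = \<beta> * \<theta>"
  unfolding mat_times_sqrt_mat
  by (simp_all add: trace_functional_def sl2_def trace_def sum_2 matrix_matrix_mult_def)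

lemma mock_FT_eq:
  assumes "\<beta> \<noteq> 0" "\<theta> \<noteq> 0" "s \<noteq> 0" "\<theta>' \<noteq> 0"
  shows "mock_FT \<mu> \<Phi> (trace_functional (mat \<beta> ** sqrt_mat \<theta>)) (mat s ** sqrt_mat \<theta>') =
    mock_FT_integral \<mu> \<Phi> \<beta> \<theta> s \<theta>'"
proof -
  have X: "\<beta> = b \<and> \<theta> = h"
    if "trace_functional (mat \<beta> ** sqrt_mat \<theta>) = trace_functional (mat b ** sqrt_mat h)" for b h
    using trace_functional_entries[of \<beta> \<theta>] trace_functional_entries[of b h] that assms by auto
  have Y: "s = b \<and> \<theta>' = h" if "mat s ** sqrt_mat \<theta>' = mat b ** sqrt_mat h" for b h
    using that assms unfolding mat_times_sqrt_mat by (auto simp: vec_eq_iff forall_2)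
  show ?thesis
    unfolding mock_FT_def
    by (rule the_equality) (use assms X Y in blast)+
qed

end

theory Submission
  imports Defs
begin

text \<open>
  The inner integral is the quadratic Gauss integral of
  \<open>\<Phi>' (a t\<^sup>2)\<close> with \<open>a = - s / x\<close>. Its shells below the depth integrate to zero, those above
  contribute their volume, and a shell hitting the depth exactly, which occurs according to the parity of
  \<open>r' - ord a\<close>, contributes a Gauss sum over the residue field. Hence the integral is
  \<open>|a|\<^bsup>-1/2\<^esup> q\<^bsup>-(r'+1)/2\<^esup>\<close> times \<open>1\<close> or \<open>sgn\<^sub>\<pi>(a) G\<^sub>\<pi>(\<Phi>')\<close>. The parity is detected by
  \<open>(1 \<plusminus> \<gamma>\<^sub>u\<^sub>n(s) sgn\<^sub>\<epsilon>(x)) / 2\<close>, and \<open>(1 + sgn\<^sub>\<theta>) / 2\<close> is the indicator of the norms, so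
  that expanding the product of these projectors yields the Bessel functions. Exchanging the
  sum over shells with this expansion is harmless because each Bessel sum has only finitely many
  non-zero terms.
\<close>

section \<open>Fractional ideals\<close>

text \<open>The two integrations are never exchanged: for each fixed \<open>x\<close> the
  \<open>t\<close>-sum is brought to closed form, and only then is the outer integrand split. All
  functions integrated over a shell are invariant there under a fixed fractional ideal, so
  measurability and integrability are questions about finitely many cosets, and the topology enters
  only through compactness of the valuation ring.

  The shape of the formula comes from a = -s/x. Its absolute value gives |s|^(-1/2) times
  nu^(1/2)(x), whence the exponent 1/2, and sgn_pi(a) = sgn_pi(-s) sgn_pi(x), whence gamma_ram(s).
  The product gamma_un(s) sgn_eps(x) equals (-1)^(r'+1+ord s+ord x), which is -1 exactly when r' -
  ord a is even, that is, when the Gauss sum occurs; hence the minus sign inside the ramified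
  bracket.

  Residual characteristic different from 2 is used in two ways: 1 + p consists of squares, so every
  sgn_theta is constant on cosets of 1 + p, and the cross term 2axy of a(x+y)^2 keeps its
  valuation.\<close>

lemma vord_1 [simp]: "vord (1::'a::nonarch_local_field) = 0"
  using vord_mult[of "1::'a" 1] by simp

lemma vord_uminus [simp]: "vord (- x) = vord (x::'a::nonarch_local_field)"
proof (cases "x = 0")
  case False
  have "vord (-1::'a) = 0"
    using vord_mult[of "-1::'a" "-1"] by simp
  then show ?thesis
    using vord_mult[of "-1::'a" x] False by simp
qed simp

lemma vord_inverse: "x \<noteq> 0 \<Longrightarrow> vord (inverse x) = - vord (x::'a::nonarch_local_field)"
  using vord_mult[of x "inverse x"] by simp

lemma vord_power: "x \<noteq> 0 \<Longrightarrow> vord (x ^ n) = int n * vord (x::'a::nonarch_local_field)"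
  by (induction n) (simp_all add: vord_mult algebra_simps)

lemma vord_powi: "x \<noteq> 0 \<Longrightarrow> vord (x powi n) = n * vord (x::'a::nonarch_local_field)"
  by (auto simp: power_int_def vord_power vord_inverse)

lemma zero_in_ppow [simp]: "0 \<in> ppow n"
  by (simp add: ppow_def)

lemma ppow_iff: "x \<noteq> 0 \<Longrightarrow> x \<in> ppow n \<longleftrightarrow> n \<le> vord x"
  by (simp add: ppow_def)

lemma ppow_mono: "x \<in> ppow m \<Longrightarrow> n \<le> m \<Longrightarrow> x \<in> ppow n"
  by (auto simp: ppow_def)

lemma ppow_add: "x \<in> ppow n \<Longrightarrow> y \<in> ppow n \<Longrightarrow> x + y \<in> ppow n"
  using vord_add[of x y] by (cases "x = 0 \<or> y = 0 \<or> x + y = 0") (auto simp: ppow_def)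

lemma ppow_uminus [simp]: "- x \<in> ppow n \<longleftrightarrow> x \<in> ppow n"
  by (simp add: ppow_def)

lemma ppow_diff: "x \<in> ppow n \<Longrightarrow> y \<in> ppow n \<Longrightarrow> x - y \<in> ppow n"
  using ppow_add[of x n "- y"] by simp

lemma ppow_diff_commute: "x - y \<in> ppow n \<longleftrightarrow> y - x \<in> ppow n"
  using ppow_uminus[of "x - y" n] by simp

lemma ppow_mult: "x \<in> ppow m \<Longrightarrow> y \<in> ppow n \<Longrightarrow> x * y \<in> ppow (m + n)"
  by (cases "x = 0 \<or> y = 0") (auto simp: ppow_def vord_mult)

lemma ppow_mult_le: "x \<in> ppow m \<Longrightarrow> y \<in> ppow n \<Longrightarrow> k \<le> m + n \<Longrightarrow> x * y \<in> ppow k"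
  by (rule ppow_mono[OF ppow_mult])

lemma one_in_val_ring [simp]: "1 \<in> val_ring"
  by (simp add: ppow_def)

lemma val_ring_power: "x \<in> val_ring \<Longrightarrow> x ^ n \<in> val_ring"
  by (induction n) (auto dest: ppow_mult)

lemma shell_eq: "shell n = ppow n - ppow (n + 1)"
  by (auto simp: shell_def ppow_def)

lemma shell_nonzero: "x \<in> shell n \<Longrightarrow> x \<noteq> 0"
  by (simp add: shell_def)

lemma shell_subset_ppow: "x \<in> shell n \<Longrightarrow> x \<in> ppow n"
  by (simp add: shell_eq)

lemma one_in_shell [simp]: "1 \<in> shell 0"
  by (simp add: shell_def)

lemma shell_uminus [simp]: "- x \<in> shell n \<longleftrightarrow> x \<in> shell n"
  by (simp add: shell_def)

lemma shell_mult: "x \<in> shell m \<Longrightarrow> y \<in> shell n \<Longrightarrow> x * y \<in> shell (m + n)"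
  by (simp add: shell_def vord_mult)

lemma shell_inverse: "x \<in> shell n \<Longrightarrow> inverse x \<in> shell (- n)"
  by (simp add: shell_def vord_inverse)

lemma shell_add: "x \<in> shell n \<Longrightarrow> y \<in> ppow (n + 1) \<Longrightarrow> x + y \<in> shell n"
  unfolding shell_eq
  using ppow_diff[of "x + y" "n + 1" y] ppow_add[of x n y] ppow_mono[of y "n + 1" n] by auto

lemma shell_add_le: "x \<in> shell n \<Longrightarrow> y \<in> ppow m \<Longrightarrow> n < m \<Longrightarrow> x + y \<in> shell n"
  by (rule shell_add) (auto elim: ppow_mono)

lemma shell_add_iff: "y \<in> ppow (n + 1) \<Longrightarrow> x + y \<in> shell n \<longleftrightarrow> x \<in> shell n"
  using shell_add[of "x + y" n "- y"] shell_add[of x n y] by auto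

lemma vord_shell: "x \<in> shell n \<Longrightarrow> vord x = n"
  by (simp add: shell_def)

lemma in_shell_vord: "x \<noteq> 0 \<Longrightarrow> x \<in> shell (vord x)"
  by (simp add: shell_def)

lemma shell_nonempty: obtains c :: "'a::nonarch_local_field" where "c \<in> shell n"
  using vord_surj[of n] by (auto simp: shell_def)

lemma ppow_div_shell: "c \<in> shell m \<Longrightarrow> x \<in> ppow n \<Longrightarrow> x / c \<in> ppow (n - m)"
  using ppow_mult[of x n "inverse c" "- m"] shell_subset_ppow[OF shell_inverse[of c m]]
  by (simp add: divide_inverse)

lemma ppow_shell_cancel: "c \<in> shell m \<Longrightarrow> c * x \<in> ppow (m + n) \<longleftrightarrow> x \<in> ppow n"
  using ppow_div_shell[of c m "c * x" "m + n"] ppow_mult[of c m x n] shell_nonzero[of c m]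
    shell_subset_ppow[of c m]
  by auto

section \<open>Topology in terms of fractional ideals\<close>

lemma stable_imp_open:
  fixes U :: "'a::nonarch_local_field set"
  assumes "\<And>x y. x \<in> U \<Longrightarrow> y \<in> ppow n \<Longrightarrow> x + y \<in> U"
  shows "open U"
  unfolding open_iff_vord
proof
  fix x assume x: "x \<in> U"
  show "\<exists>n. \<forall>y. y \<noteq> x \<longrightarrow> n \<le> vord (y - x) \<longrightarrow> y \<in> U"
  proof (intro exI[of _ n] allI impI)
    fix y assume "y \<noteq> x" "n \<le> vord (y - x)"
    then show "y \<in> U"
      using assms[OF x, of "y - x"] by (simp add: ppow_iff)
  qed
qed

lemma open_ppow_nbhd:
  fixes U :: "'a::nonarch_local_field set"
  assumes "open U" "x \<in> U"
  obtains n where "\<And>y. y \<in> ppow n \<Longrightarrow> x + y \<in> U"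
proof -
  obtain n where n: "\<And>y. y \<noteq> x \<Longrightarrow> n \<le> vord (y - x) \<Longrightarrow> y \<in> U"
    using assms unfolding open_iff_vord by meson
  show thesis
  proof
    fix y :: 'a assume "y \<in> ppow n"
    then show "x + y \<in> U"
      using n[of "x + y"] assms(2) by (cases "y = 0") (auto simp: ppow_def)
  qed
qed

lemma open_ppow_coset: "open {x. x - a \<in> ppow n}" for a :: "'a::nonarch_local_field"
proof (rule stable_imp_open)
  fix x y :: 'a assume "x \<in> {x. x - a \<in> ppow n}" "y \<in> ppow n"
  then show "x + y \<in> {x. x - a \<in> ppow n}"
    using ppow_add[of "x - a" n y] by (simp add: algebra_simps)
qed

lemma open_ppow: "open (ppow n :: 'a::nonarch_local_field set)"
  using open_ppow_coset[of 0 n] by simp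

lemma open_shell: "open (shell n :: 'a::nonarch_local_field set)"
  by (rule stable_imp_open) (rule shell_add)

lemma closed_ppow: "closed (ppow n :: 'a::nonarch_local_field set)"
  unfolding closed_def
proof (rule stable_imp_open)
  fix x y :: 'a assume "x \<in> - ppow n" "y \<in> ppow n"
  then show "x + y \<in> - ppow n"
    using ppow_diff[of "x + y" n y] by auto
qed

text \<open>The class postulates a field with a topology described by \<open>vord\<close>, not a
  topological ring, so continuity of the operations has to be derived from
  \<open>open_iff_vord\<close>.\<close>

lemma continuous_mult_const: "continuous_on UNIV (\<lambda>x::'a::nonarch_local_field. c * x)"
proof (cases "c = 0")
  case False
  have "open ((\<lambda>x. c * x) -` U)" if U: "open U" for U :: "'a set"
    unfolding open_iff_vord
  proof
    fix x assume "x \<in> (\<lambda>x. c * x) -` U"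
    then have "c * x \<in> U"
      by simp
    then obtain n where n: "\<And>y. y \<in> ppow n \<Longrightarrow> c * x + y \<in> U"
      using open_ppow_nbhd[OF U, of "c * x"] by blast
    show "\<exists>n. \<forall>y. y \<noteq> x \<longrightarrow> n \<le> vord (y - x) \<longrightarrow> y \<in> (\<lambda>x. c * x) -` U"
    proof (intro exI[of _ "n - vord c"] allI impI)
      fix y assume y: "y \<noteq> x" "n - vord c \<le> vord (y - x)"
      have "c * (y - x) \<in> ppow n"
        using y False by (auto simp: ppow_def vord_mult)
      from n[OF this] show "y \<in> (\<lambda>x. c * x) -` U"
        by (simp add: algebra_simps)
    qed
  qed
  then show ?thesis
    by (simp add: continuous_on_open_vimage)
qed simp

text \<open>A compact neighbourhood of 0 contains some p^n, which is closed and therefore compact;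
  multiplication by an element of valuation -n carries it onto the valuation ring.\<close>

lemma compact_val_ring: "compact (val_ring :: 'a::nonarch_local_field set)"
proof -
  obtain U K :: "'a set" where UK: "open U" "compact K" "0 \<in> U" "U \<subseteq> K"
    using locally_compact_field[of 0] by blast
  obtain n where n: "\<And>y. y \<in> ppow n \<Longrightarrow> 0 + y \<in> U"
    using open_ppow_nbhd[OF UK(1,3)] by blast
  have "ppow n = K \<inter> ppow n"
    using n UK(4) by auto
  then have cpt: "compact (ppow n :: 'a set)"
    using compact_Int_closed[OF UK(2) closed_ppow[of n]] by simp
  obtain c :: 'a where c: "c \<in> shell (- n)"
    by (rule shell_nonempty)
  have "val_ring = (\<lambda>x. c * x) ` ppow n"
  proof (intro equalityI subsetI)
    fix x :: 'a assume "x \<in> val_ring"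
    then show "x \<in> (\<lambda>x. c * x) ` ppow n"
      using ppow_div_shell[OF c, of x 0] shell_nonzero[OF c]
      by (intro image_eqI[of _ _ "x / c"]) auto
  next
    fix x assume "x \<in> (\<lambda>x. c * x) ` ppow n"
    then show "x \<in> val_ring"
      using ppow_mult[OF shell_subset_ppow[OF c], of _ n] by auto
  qed
  then show ?thesis
    using compact_continuous_image[OF continuous_on_subset[OF continuous_mult_const] cpt]
    by simp
qed

section \<open>The residue field\<close>

text \<open>These are exactly the representatives chosen in \<open>gauss_sum\<close>, so that sums
  over residue classes become sums over field elements.\<close>

definition residue_reps :: "'a::nonarch_local_field set" where
  "residue_reps = (\<lambda>C. SOME X. X \<in> C) ` residue_classes"

lemma residue_class_coset:
  assumes "C \<in> residue_classes" "x \<in> C"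
  shows "x \<in> val_ring" "C = {y. y - x \<in> max_ideal}"
proof -
  obtain a where a: "a \<in> val_ring" "C = {y. y \<in> val_ring \<and> a - y \<in> max_ideal}"
    using assms(1) by (auto simp: residue_classes_def quotient_def)
  show x: "x \<in> val_ring"
    using a assms(2) by auto
  have "y \<in> val_ring" if "y - x \<in> max_ideal" for y
    using ppow_add[of "y - x" 0 x] ppow_mono[of "y - x" 1 0] that x by simp
  moreover have "a - y \<in> max_ideal \<longleftrightarrow> y - x \<in> max_ideal" for y
    using ppow_diff[of "a - x" 1 "y - x"] ppow_diff[of "a - x" 1 "a - y"] a assms(2) by auto
  ultimately show "C = {y. y - x \<in> max_ideal}"
    unfolding a(2) by auto
qed

lemma residue_class_of:
  assumes "x \<in> val_ring"
  shows "{y. y - x \<in> max_ideal} \<in> residue_classes"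
proof -
  let ?C = "{y. y \<in> val_ring \<and> x - y \<in> max_ideal}"
  have C: "?C \<in> residue_classes"
    using assms by (auto simp: residue_classes_def quotient_def)
  moreover have "x \<in> ?C" using assms by simp
  ultimately have "?C = {y. y - x \<in> max_ideal}"
    by (rule residue_class_coset(2))
  then show ?thesis using C by simp
qed

lemma residue_class_some:
  assumes "C \<in> residue_classes"
  shows "(SOME X. X \<in> C) \<in> C"
proof -
  have "\<exists>x. x \<in> C"
    using assms by (auto simp: residue_classes_def quotient_def)
  then show ?thesis by (rule someI_ex)
qed

text \<open>The classes cover the compact valuation ring by pairwise disjoint non-empty open sets,
  so a finite subcover must already contain all of them.\<close>

lemma finite_residue_classes: "finite (residue_classes :: 'a::nonarch_local_field set set)"
proof -
  have op: "open C" if C: "C \<in> residue_classes" for C :: "'a set"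
    by (subst residue_class_coset(2)[OF C residue_class_some[OF C]]) (rule open_ppow_coset)
  have cov: "(val_ring :: 'a set) \<subseteq> \<Union>residue_classes"
  proof
    fix x :: 'a assume "x \<in> val_ring"
    then show "x \<in> \<Union>residue_classes"
      by (intro UnionI[OF residue_class_of]) auto
  qed
  obtain D where D: "D \<subseteq> (residue_classes :: 'a set set)" "finite D" "val_ring \<subseteq> \<Union>D"
    by (rule compactE[OF compact_val_ring cov op])
  have "C \<in> D" if C: "C \<in> residue_classes" for C
  proof -
    define x where "x = (SOME X. X \<in> C)"
    have x: "x \<in> C" unfolding x_def by (rule residue_class_some[OF C])
    then obtain E where E: "E \<in> D" "x \<in> E"
      using D(3) residue_class_coset(1)[OF C x] by blast
    moreover have "C = E"
      by (rule trans[OF residue_class_coset(2)[OF C x] sym[OF residue_class_coset(2)]])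
        (use E D(1) in auto)
    ultimately show ?thesis by simp
  qed
  then have "residue_classes \<subseteq> D" ..
  then show ?thesis
    using D(2) by (rule finite_subset)
qed

lemma inj_residue_some:
  "inj_on (\<lambda>C. SOME X. X \<in> C) (residue_classes :: 'a::nonarch_local_field set set)"
proof (rule inj_onI)
  fix C D :: "'a set"
  assume C: "C \<in> residue_classes" and D: "D \<in> residue_classes"
    and eq: "(SOME X. X \<in> C) = (SOME X. X \<in> D)"
  show "C = D"
    by (rule trans[OF residue_class_coset(2)[OF C residue_class_some[OF C]]
          sym[OF residue_class_coset(2)[OF D]]])
      (simp add: eq residue_class_some[OF D])
qed

lemma finite_residue_reps [simp]: "finite (residue_reps :: 'a::nonarch_local_field set)"
  by (simp add: residue_reps_def finite_residue_classes)

lemma card_residue_reps: "card (residue_reps :: 'a::nonarch_local_field set) = residue_card TYPE('a)"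
  by (simp add: residue_reps_def card_image inj_residue_some residue_card_def)

lemma residue_reps_val_ring: "x \<in> residue_reps \<Longrightarrow> x \<in> val_ring"
  unfolding residue_reps_def
  by (auto intro: residue_class_coset(1)[OF _ residue_class_some])

lemma residue_reps_unique:
  assumes "x \<in> residue_reps" "y \<in> residue_reps" "x - y \<in> max_ideal"
  shows "x = y"
proof -
  obtain C where C: "C \<in> residue_classes" "x = (SOME X. X \<in> C)"
    using assms(1) by (auto simp: residue_reps_def)
  obtain D where D: "D \<in> residue_classes" "y = (SOME X. X \<in> D)"
    using assms(2) by (auto simp: residue_reps_def)
  have x: "x \<in> C" and y: "y \<in> D"
    using residue_class_some[OF C(1)] residue_class_some[OF D(1)] C(2) D(2) by simp_all
  have "x \<in> {z. z - y \<in> max_ideal}"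
    using assms(3) by simp
  then have xD: "x \<in> D"
    by (simp only: residue_class_coset(2)[OF D(1) y, symmetric])
  have "C = D"
    by (rule trans[OF residue_class_coset(2)[OF C(1) x]
          sym[OF residue_class_coset(2)[OF D(1) xD]]])
  then show ?thesis using C D by simp
qed

text \<open>Phrased so that it unfolds to the same choice as in \<open>residue_reps\<close>, applied
  to the class of \<open>x\<close>; it therefore depends on \<open>x\<close> only modulo the maximal
  ideal.\<close>

definition residue_rep :: "'a::nonarch_local_field \<Rightarrow> 'a" where
  "residue_rep x = (SOME X. X - x \<in> max_ideal)"

lemma residue_rep:
  assumes "x \<in> val_ring"
  shows "residue_rep x \<in> residue_reps" "residue_rep x - x \<in> max_ideal"
proof -
  have C: "{y. y - x \<in> max_ideal} \<in> residue_classes"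
    by (rule residue_class_of[OF assms])
  show "residue_rep x - x \<in> max_ideal"
    using residue_class_some[OF C] by (simp add: residue_rep_def)
  show "residue_rep x \<in> residue_reps"
    unfolding residue_reps_def residue_rep_def using imageI[OF C, of "\<lambda>C. SOME X. X \<in> C"] by simp
qed

lemma residue_rep_unit:
  assumes "x \<in> shell 0"
  shows "residue_rep x \<in> residue_reps - max_ideal"
proof -
  note r = residue_rep[OF shell_subset_ppow[OF assms]]
  have "residue_rep x \<notin> max_ideal"
    using ppow_diff[of "residue_rep x" 1 "residue_rep x - x"] r(2) assms by (auto simp: shell_eq)
  then show ?thesis using r(1) by simp
qed

lemma residue_rep_eqI:
  assumes "x \<in> val_ring" "r \<in> residue_reps" "x - r \<in> max_ideal"
  shows "residue_rep x = r"
  using residue_rep[OF assms(1)] assms ppow_add[of "residue_rep x - x" 1 "x - r"]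
  by (intro residue_reps_unique) auto

lemma residue_rep_cong_iff:
  assumes "x \<in> val_ring" "y \<in> val_ring"
  shows "residue_rep x = residue_rep y \<longleftrightarrow> x - y \<in> max_ideal"
proof
  assume "residue_rep x = residue_rep y"
  then show "x - y \<in> max_ideal"
    using ppow_diff[OF residue_rep(2)[OF assms(2)] residue_rep(2)[OF assms(1)]] by simp
next
  assume "x - y \<in> max_ideal"
  then show "residue_rep x = residue_rep y"
    using ppow_add[of "x - y" 1 "y - residue_rep y"] residue_rep[OF assms(2)] assms(1)
    by (intro residue_rep_eqI) (auto simp: ppow_diff_commute)
qed

lemma residue_card_ge_2: "2 \<le> residue_card TYPE('a::nonarch_local_field)"
proof -
  let ?A = "{residue_rep 0, residue_rep 1 :: 'a}"
  have "residue_rep 0 \<noteq> (residue_rep 1 :: 'a)"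
    by (subst residue_rep_cong_iff) (auto simp: ppow_def)
  moreover have "?A \<subseteq> residue_reps"
    using residue_rep(1)[of "0::'a"] residue_rep(1)[of "1::'a"] by simp
  ultimately show ?thesis
    using card_mono[OF finite_residue_reps, of ?A] by (simp add: card_residue_reps)
qed

text \<open>A map that is injective modulo p permutes the finite set of residue classes. It need
  neither preserve the chosen representatives nor be additive: it is used for translations and for
  multiplication by a unit.\<close>

lemma sum_residue_reps_reindex:
  fixes f :: "'a::nonarch_local_field \<Rightarrow> 'a" and h :: "'a \<Rightarrow> 'b::comm_monoid_add"
  assumes f: "\<And>x. x \<in> val_ring \<Longrightarrow> f x \<in> val_ring"
    and inj: "\<And>x y. x \<in> val_ring \<Longrightarrow> y \<in> val_ring \<Longrightarrow> f x - f y \<in> max_ideal \<Longrightarrow> x - y \<in> max_ideal"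
    and h: "\<And>x y. x \<in> val_ring \<Longrightarrow> y \<in> val_ring \<Longrightarrow> x - y \<in> max_ideal \<Longrightarrow> h x = h y"
  shows "(\<Sum>x\<in>residue_reps. h (f x)) = (\<Sum>x\<in>residue_reps. h x)"
proof -
  let ?g = "\<lambda>x. residue_rep (f x)"
  have "inj_on ?g residue_reps"
  proof (rule inj_onI)
    fix x y assume xy: "x \<in> residue_reps" "y \<in> residue_reps" "?g x = ?g y"
    note O = xy(1,2)[THEN residue_reps_val_ring]
    have "f x - f y \<in> max_ideal"
      using xy(3) residue_rep_cong_iff[OF O[THEN f]] by simp
    then show "x = y"
      by (rule residue_reps_unique[OF xy(1,2) inj[OF O]])
  qed
  moreover have "?g ` residue_reps \<subseteq> residue_reps"
    by (auto intro: residue_rep(1) f residue_reps_val_ring)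
  ultimately have "bij_betw ?g residue_reps residue_reps"
    using endo_inj_surj[OF finite_residue_reps, of ?g] unfolding bij_betw_def by blast
  then have "(\<Sum>x\<in>residue_reps. h x) = (\<Sum>x\<in>residue_reps. h (?g x))"
    by (rule sum.reindex_bij_betw[symmetric])
  also have "\<dots> = (\<Sum>x\<in>residue_reps. h (f x))"
    by (intro sum.cong refl h) (auto simp: residue_rep f residue_reps_val_ring)
  finally show ?thesis by simp
qed

text \<open>Orthogonality: translation by \<open>a\<close> permutes the classes, so the sum is fixed
  under multiplication by \<open>\<psi> a\<close>, which differs from 1.\<close>

lemma sum_residue_reps_character:
  fixes \<psi> :: "'a::nonarch_local_field \<Rightarrow> complex"
  assumes add: "\<And>x y. \<psi> (x + y) = \<psi> x * \<psi> y"
    and trivial: "\<And>x. x \<in> max_ideal \<Longrightarrow> \<psi> x = 1"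
    and a: "a \<in> val_ring" "\<psi> a \<noteq> 1"
  shows "(\<Sum>x\<in>residue_reps. \<psi> x) = 0"
proof -
  have cong: "\<psi> x = \<psi> y" if "x - y \<in> max_ideal" for x y
    using add[of "x - y" y] trivial[OF that] by simp
  have "(\<Sum>x\<in>residue_reps. \<psi> (a + x)) = (\<Sum>x\<in>residue_reps. \<psi> x)"
    by (rule sum_residue_reps_reindex) (use a cong in \<open>auto intro: ppow_add\<close>)
  then have "\<psi> a * (\<Sum>x\<in>residue_reps. \<psi> x) = (\<Sum>x\<in>residue_reps. \<psi> x)"
    by (simp add: add sum_distrib_left)
  then show ?thesis using a(2) by simp
qed

section \<open>Squares\<close>

lemma max_ideal_prime:
  fixes x y :: "'a::nonarch_local_field"
  assumes "x \<in> val_ring" "y \<in> val_ring" "x * y \<in> max_ideal"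
  shows "x \<in> max_ideal \<or> y \<in> max_ideal"
  using assms by (cases "x = 0 \<or> y = 0") (auto simp: ppow_def vord_mult)

lemma two_mult_val_ring: "x \<in> val_ring \<Longrightarrow> 2 * x \<in> val_ring"
  using ppow_add[of x 0 x] by (simp only: mult_2)

lemma two_in_shell:
  assumes "residual_char_not_2 TYPE('a::nonarch_local_field)"
  shows "(2::'a) \<in> shell 0"
  using assms ppow_add[OF one_in_val_ring one_in_val_ring, where ?'a = 'a]
  by (simp add: shell_eq residual_char_not_2_def)

text \<open>Newton iteration: if 2wd = w^2 - z, then (w - d)^2 - z is exactly d^2, and
  \<open>w - d\<close> remains a unit. Since 2 is a unit, \<open>d\<close> is as small as the
  previous error.\<close>

lemma approximate_square_root:
  fixes z :: "'a::nonarch_local_field"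
  assumes "residual_char_not_2 TYPE('a)" "z - 1 \<in> max_ideal"
  shows "\<exists>w\<in>shell 0. w\<^sup>2 - z \<in> ppow (int n + 1)"
proof (induction n)
  case 0
  show ?case
    using assms(2) by (intro bexI[of _ 1]) (auto simp: ppow_diff_commute)
next
  case (Suc n)
  then obtain w where w: "w \<in> shell 0" "w\<^sup>2 - z \<in> ppow (int n + 1)"
    by blast
  have w2: "2 * w \<in> shell 0"
    using shell_mult[OF two_in_shell[OF assms(1)] w(1)] by simp
  define d where "d = (w\<^sup>2 - z) / (2 * w)"
  have d: "d \<in> ppow (int n + 1)"
    using ppow_div_shell[OF w2 w(2)] by (simp add: d_def)
  have "2 * w * d = w\<^sup>2 - z"
    using shell_nonzero[OF w2] by (simp add: d_def)
  then have "(w + (- d))\<^sup>2 - z = d * d"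
    by (simp add: power2_eq_square algebra_simps)
  moreover have "d * d \<in> ppow (int (Suc n) + 1)"
    by (rule ppow_mult_le[OF d d]) simp
  moreover have "w + (- d) \<in> shell 0"
    by (rule shell_add_le[OF w(1)]) (use d in auto)
  ultimately show ?case by (intro bexI[of _ "w + (- d)"]) auto
qed

text \<open>Failing to be a square root of \<open>z\<close> at a finite precision is an open
  condition, because (w + y)^2 - w^2 = y(2w + y).\<close>

lemma open_square_avoiding: "open {w \<in> val_ring. w\<^sup>2 - z \<notin> ppow k}" for z :: "'a::nonarch_local_field"
proof (rule stable_imp_open)
  fix w y :: 'a
  assume w: "w \<in> {w \<in> val_ring. w\<^sup>2 - z \<notin> ppow k}" and y: "y \<in> ppow (max k 0)"
  have y0: "y \<in> val_ring" and yk: "y \<in> ppow k"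
    using y by (auto elim: ppow_mono)
  have "2 * w + y \<in> val_ring"
    using w by (intro ppow_add y0 two_mult_val_ring) simp
  then have "y * (2 * w + y) \<in> ppow k"
    by (rule ppow_mult_le[OF yk]) simp
  moreover have "w\<^sup>2 - z = (w + y)\<^sup>2 - z - y * (2 * w + y)"
    by (simp add: power2_eq_square algebra_simps)
  ultimately have "(w + y)\<^sup>2 - z \<notin> ppow k"
    using w ppow_diff[of "(w + y)\<^sup>2 - z" k "y * (2 * w + y)"] by (simp only: mem_Collect_eq) blast
  then show "w + y \<in> {w \<in> val_ring. w\<^sup>2 - z \<notin> ppow k}"
    using w y0 ppow_add[of w 0 y] by simp
qed

text \<open>Compactness of the valuation ring replaces completeness in Hensel's lemma.\<close>

lemma square_root_of_principal_unit:
  fixes z :: "'a::nonarch_local_field"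
  assumes "residual_char_not_2 TYPE('a)" "z - 1 \<in> max_ideal"
  shows "\<exists>w. z = w\<^sup>2"
proof (rule ccontr)
  assume no: "\<nexists>w. z = w\<^sup>2"
  let ?U = "\<lambda>k. {w \<in> val_ring. w\<^sup>2 - z \<notin> ppow k}"
  \<comment> \<open>Without an exact root, every \<open>w\<close> fails at some finite level
    \<open>k\<close>. A finite subcover bounds these levels uniformly, which contradicts the
    existence of approximate roots of every precision.\<close>
  have "(val_ring :: 'a set) \<subseteq> (\<Union>k\<in>UNIV. ?U k)"
  proof
    fix w :: 'a assume w: "w \<in> val_ring"
    have "w\<^sup>2 - z \<noteq> 0" using no by auto
    then have "w\<^sup>2 - z \<notin> ppow (vord (w\<^sup>2 - z) + 1)"
      by (simp add: ppow_iff)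
    with w show "w \<in> (\<Union>k\<in>UNIV. ?U k)" by blast
  qed
  then obtain C where C: "finite C" "(val_ring :: 'a set) \<subseteq> (\<Union>k\<in>C. ?U k)"
    by (rule compactE_image[OF compact_val_ring open_square_avoiding])
  define n where "n = nat (Max (insert 0 C))"
  have n: "k \<le> int n" if "k \<in> C" for k
    using C(1) that Max_ge[of "insert 0 C" k] by (simp add: n_def)
  obtain w where w: "w \<in> shell 0" "w\<^sup>2 - z \<in> ppow (int n + 1)"
    using approximate_square_root[OF assms] by blast
  then obtain k where k: "k \<in> C" "w\<^sup>2 - z \<notin> ppow k"
    using C(2) shell_subset_ppow[OF w(1)] by auto
  then show False
    using ppow_mono[OF w(2), of k] n[OF k(1)] by simp
qed

section \<open>Square classes\<close>

definition is_square :: "'a::nonarch_local_field \<Rightarrow> bool" where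
  "is_square x \<longleftrightarrow> (\<exists>y. x = y\<^sup>2)"

lemma is_square_power2 [simp]: "is_square (y\<^sup>2)"
  by (auto simp: is_square_def)

lemma is_square_mult_power2_iff:
  assumes "a \<noteq> 0"
  shows "is_square (x * a\<^sup>2) \<longleftrightarrow> is_square x"
proof
  assume "is_square (x * a\<^sup>2)"
  then obtain y where "x * a\<^sup>2 = y\<^sup>2" by (auto simp: is_square_def)
  then have "x = (y / a)\<^sup>2"
    using assms by (simp add: field_simps)
  then show "is_square x" by simp
next
  assume "is_square x"
  then obtain y where "x = y\<^sup>2" by (auto simp: is_square_def)
  then have "x * a\<^sup>2 = (y * a)\<^sup>2" by (simp add: power_mult_distrib)
  then show "is_square (x * a\<^sup>2)" by simp
qed

lemma even_vord_square: "is_square x \<Longrightarrow> x \<noteq> 0 \<Longrightarrow> even (vord x)"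
  by (auto simp: is_square_def vord_power)

text \<open>The coset x(1 + p) lies in a single square class. This is the source of the local
  constancy of all sign characters.\<close>

lemma perturbation_by_square:
  fixes x y :: "'a::nonarch_local_field"
  assumes "residual_char_not_2 TYPE('a)" "x \<in> shell n" "y \<in> ppow (n + 1)"
  obtains w where "w \<noteq> 0" "x + y = x * w\<^sup>2"
proof -
  have "y / x \<in> max_ideal"
    using ppow_div_shell[OF assms(2,3)] by simp
  then obtain w where w: "1 + y / x = w\<^sup>2"
    using square_root_of_principal_unit[OF assms(1), of "1 + y / x"] by auto
  then have eq: "x + y = x * w\<^sup>2"
    using shell_nonzero[OF assms(2)] by (simp add: field_simps flip: w)
  then have "w \<noteq> 0"
    using shell_nonzero[OF shell_add[OF assms(2,3)]] by auto
  then show thesis using eq that by blast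
qed

lemma is_square_if_square_mod_max_ideal:
  fixes x y :: "'a::nonarch_local_field"
  assumes "residual_char_not_2 TYPE('a)" "x \<in> shell 0" "x - y\<^sup>2 \<in> max_ideal"
  shows "is_square x"
proof -
  have "- (x - y\<^sup>2) \<in> ppow (0 + 1)"
    using assms(3) ppow_uminus[of "x - y\<^sup>2" 1] by simp
  then obtain w where w: "w \<noteq> 0" "x + - (x - y\<^sup>2) = x * w\<^sup>2"
    using perturbation_by_square[OF assms(1,2)] by blast
  then have "is_square (x * w\<^sup>2)"
    by (metis add_uminus_conv_diff diff_diff_eq2 add_diff_cancel_left' is_square_power2)
  then show ?thesis
    using is_square_mult_power2_iff[OF w(1)] by blast
qed

text \<open>Passes between squares in the residue field and squares in the field itself. In
  particular any non-square unit may take the part of \<open>\<epsilon>\<close> in the counting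
  results below.\<close>

lemma lifts_nonsquare_iff:
  fixes x :: "'a::nonarch_local_field"
  assumes "residual_char_not_2 TYPE('a)" "x \<in> shell 0"
  shows "lifts_nonsquare x \<longleftrightarrow> \<not> is_square x"
proof
  assume l: "lifts_nonsquare x"
  show "\<not> is_square x"
  proof
    assume "is_square x"
    then obtain y where y: "x = y\<^sup>2" by (auto simp: is_square_def)
    then have "y \<in> val_ring"
      using assms(2) by (cases "y = 0") (auto simp: shell_def ppow_def vord_power)
    then show False
      using l y by (auto simp: lifts_nonsquare_def)
  qed
next
  assume "\<not> is_square x"
  then show "lifts_nonsquare x"
    using is_square_if_square_mod_max_ideal[OF assms] assms(2) by (auto simp: lifts_nonsquare_def)
qed

section \<open>Counting squares modulo the maximal ideal\<close>

context
  fixes c :: "'a::nonarch_local_field"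
  assumes char: "residual_char_not_2 TYPE('a)" and c: "lifts_nonsquare c"
begin

lemma nonsquare_in_shell: "c \<in> shell 0"
  using c by (simp add: lifts_nonsquare_def)

lemma nonsquare_in_val_ring: "c \<in> val_ring"
  by (rule shell_subset_ppow[OF nonsquare_in_shell])

text \<open>
  Each non-zero residue class has at most two preimages under \<open>x \<mapsto> x\<^sup>2\<close> and \<open>x \<mapsto> c x\<^sup>2\<close>
  together, because not both fibres can be inhabited; comparing totals forces equality.
\<close>

lemma card_square_fibres:
  fixes z :: 'a
  defines "U \<equiv> residue_reps - max_ideal :: 'a set"
  assumes z: "z \<in> U"
  shows "card {x \<in> U. residue_rep (x\<^sup>2) = z} + card {x \<in> U. residue_rep (c * x\<^sup>2) = z} = 2"
proof -
  let ?F = "\<lambda>d z. {x \<in> U. residue_rep (d * x\<^sup>2) = z}"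
  have fin: "finite U" by (simp add: U_def)
  have U: "x \<in> residue_reps" "x \<in> val_ring" "x \<in> shell 0" if "x \<in> U" for x
    using that by (auto simp: U_def residue_reps_val_ring shell_eq)
  have sq: "d * x\<^sup>2 \<in> shell 0" if "x \<in> U" "d \<in> shell 0" for d x
    using shell_mult[OF that(2) shell_mult[OF U(3)[OF that(1)] U(3)[OF that(1)]]]
    by (simp add: power2_eq_square)
  have fibre: "card (?F d z) \<le> 2" if d: "d \<in> shell 0" for d z
  proof (cases "?F d z = {}")
    case False
    then obtain x0 where x0: "x0 \<in> U" "residue_rep (d * x0\<^sup>2) = z" by blast
    \<comment> \<open>From d(x^2 - x0^2) = 0 in the residue field, primality of p gives x = x0 or x
      = -x0 there.\<close>
    have "?F d z \<subseteq> {x0, residue_rep (- x0)}"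
    proof
      fix x assume x: "x \<in> ?F d z"
      then have xU: "x \<in> U" by simp
      have "residue_rep (d * x\<^sup>2) = residue_rep (d * x0\<^sup>2)"
        using x x0 by simp
      then have "d * x\<^sup>2 - d * x0\<^sup>2 \<in> max_ideal"
        by (subst (asm) residue_rep_cong_iff)
          (auto intro!: shell_subset_ppow sq d xU x0)
      then have "d * ((x - x0) * (x + x0)) \<in> ppow (0 + 1)"
        by (simp add: power2_eq_square algebra_simps)
      then have "(x - x0) * (x + x0) \<in> max_ideal"
        by (simp only: ppow_shell_cancel[OF d])
      then have "x - x0 \<in> max_ideal \<or> x + x0 \<in> max_ideal"
        by (rule max_ideal_prime[OF ppow_diff[OF U(2)[OF xU] U(2)[OF x0(1)]]
              ppow_add[OF U(2)[OF xU] U(2)[OF x0(1)]]])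
      then show "x \<in> {x0, residue_rep (- x0)}"
      proof
        assume "x - x0 \<in> max_ideal"
        then show ?thesis
          using residue_reps_unique[OF U(1)[OF xU] U(1)[OF x0(1)]] by simp
      next
        assume "x + x0 \<in> max_ideal"
        then have "residue_rep (- x0) = x"
          using U(2)[OF x0(1)] ppow_uminus[of "x + x0" 1] U(1)[OF xU]
          by (intro residue_rep_eqI) (auto simp: algebra_simps)
        then show ?thesis by simp
      qed
    qed
    then have "card (?F d z) \<le> card {x0, residue_rep (- x0)}"
      by (rule card_mono[rotated]) simp
    also have "\<dots> \<le> 2"
      by (simp add: card_insert_if)
    finally show ?thesis .
  next
    case True
    then show ?thesis by (simp only: card.empty)
  qed
  \<comment> \<open>A class hit by both x^2 and c y^2 would make \<open>c\<close> congruent to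
    (x/y)^2.\<close>
  have disj: "?F 1 z = {} \<or> ?F c z = {}" for z
  proof (rule ccontr)
    assume "\<not> ?thesis"
    then obtain x y where x: "x \<in> U" "residue_rep (1 * x\<^sup>2) = z"
      and y: "y \<in> U" "residue_rep (c * y\<^sup>2) = z" by blast
    have eq: "residue_rep (c * y\<^sup>2) = residue_rep (1 * x\<^sup>2)"
      using x y by simp
    have "1 * x\<^sup>2 \<in> val_ring" "c * y\<^sup>2 \<in> val_ring"
      by (intro shell_subset_ppow sq x y nonsquare_in_shell one_in_shell)+
    then have "c * y\<^sup>2 - 1 * x\<^sup>2 \<in> max_ideal"
      using eq by (simp only: residue_rep_cong_iff)
    moreover have "y\<^sup>2 \<in> shell 0"
      using sq[OF y(1) one_in_shell] by simp
    ultimately have "(c * y\<^sup>2 - 1 * x\<^sup>2) / y\<^sup>2 \<in> ppow (1 - 0)"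
      by (intro ppow_div_shell)
    then have "c - (x / y)\<^sup>2 \<in> max_ideal"
      using shell_nonzero[OF U(3)[OF y(1)]] by (simp add: diff_divide_distrib power_divide)
    moreover have "x / y \<in> val_ring"
      using ppow_div_shell[OF U(3)[OF y(1)] U(2)[OF x(1)]] by simp
    ultimately show False
      using c by (simp add: lifts_nonsquare_def)
  qed
  let ?n = "\<lambda>z. card (?F 1 z) + card (?F c z)"
  have le: "?n z \<le> 2" for z
    using fibre[OF one_in_shell, of z] fibre[OF nonsquare_in_shell, of z] disj[of z]
    by (elim disjE) (simp_all only: card.empty add_0 add_0_right)
  \<comment> \<open>Every element of \<open>U\<close> lies in exactly one fibre, so the two maps
    together contribute twice the size of \<open>U\<close>. This is the total that each fibre count
    attaining its bound 2 would give, so none can be smaller.\<close>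
  have total: "(\<Sum>z\<in>U. card (?F d z)) = card U" if d: "d \<in> shell 0" for d
  proof -
    have "residue_rep (d * x\<^sup>2) \<in> U" if "x \<in> U" for x
      unfolding U_def by (rule residue_rep_unit[OF sq[OF that d]])
    then have "(\<lambda>x. residue_rep (d * x\<^sup>2)) ` U \<subseteq> U" by blast
    then show ?thesis
      using sum.group[OF fin fin, of "\<lambda>x. residue_rep (d * x\<^sup>2)" "\<lambda>_. 1::nat"]
      by simp
  qed
  have "(\<Sum>z\<in>U. ?n z) = (\<Sum>z\<in>U. 2)"
    using total[OF one_in_shell] total[OF nonsquare_in_shell] by (simp add: sum.distrib)
  moreover have "(\<Sum>z\<in>U. ?n z) < (\<Sum>z\<in>U. 2)" if "?n z < 2"
    by (rule sum_strict_mono_ex1[OF fin]) (use le z that in blast)+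
  ultimately show ?thesis using le[of z] by fastforce
qed

text \<open>On non-zero classes this is the fibre count, and the zero class is hit once by each map,
  again giving the factor 2. When \<open>h\<close> is a non-trivial additive character the right
  side vanishes, so twisting a quadratic Gauss sum by \<open>c\<close> reverses its sign.\<close>

lemma sum_over_squares:
  fixes h :: "'a \<Rightarrow> complex"
  assumes h: "\<And>x y. x \<in> val_ring \<Longrightarrow> y \<in> val_ring \<Longrightarrow> x - y \<in> max_ideal \<Longrightarrow> h x = h y"
  shows "(\<Sum>x\<in>residue_reps. h (x\<^sup>2)) + (\<Sum>x\<in>residue_reps. h (c * x\<^sup>2)) = 2 * (\<Sum>x\<in>residue_reps. h x)"
proof -
  define U V where "U = residue_reps - (max_ideal :: 'a set)"
    and "V = residue_reps \<inter> (max_ideal :: 'a set)"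
  have fin: "finite U" "finite V" "U \<inter> V = {}" "residue_reps = U \<union> V"
    by (auto simp: U_def V_def)
  have U: "x \<in> shell 0" if "x \<in> U" for x
    using that by (auto simp: U_def residue_reps_val_ring shell_eq)
  have split: "(\<Sum>x\<in>residue_reps. g x) = (\<Sum>x\<in>U. g x) + (\<Sum>x\<in>V. g x)" for g :: "'a \<Rightarrow> complex"
    unfolding fin(4) by (rule sum.union_disjoint) (use fin in auto)
  have V: "(\<Sum>x\<in>V. h (d * x\<^sup>2)) = (\<Sum>x\<in>V. h x)" if d: "d \<in> val_ring" for d
  proof (rule sum.cong[OF refl])
    fix x assume "x \<in> V"
    then have x: "x \<in> max_ideal" "x \<in> val_ring"
      by (auto simp: V_def residue_reps_val_ring)
    have "d * x\<^sup>2 \<in> max_ideal"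
      using ppow_mult[OF d ppow_mult[OF x]] by (simp add: power2_eq_square)
    then show "h (d * x\<^sup>2) = h x"
      using x by (intro h ppow_diff) (auto elim: ppow_mono)
  qed
  have fib: "(\<Sum>x\<in>U. h (d * x\<^sup>2)) = (\<Sum>z\<in>U. of_nat (card {x \<in> U. residue_rep (d * x\<^sup>2) = z}) * h z)"
    if d: "d \<in> shell 0" for d
  proof -
    have sq: "d * x\<^sup>2 \<in> shell 0" if "x \<in> U" for x
      using shell_mult[OF d shell_mult[OF U[OF that] U[OF that]]]
      by (simp add: power2_eq_square)
    have rU: "residue_rep (d * x\<^sup>2) \<in> U" if "x \<in> U" for x
      unfolding U_def by (rule residue_rep_unit[OF sq[OF that]])
    have "(\<Sum>x\<in>U. h (d * x\<^sup>2)) = (\<Sum>x\<in>U. h (residue_rep (d * x\<^sup>2)))"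
      using residue_rep[OF shell_subset_ppow[OF sq]] shell_subset_ppow[OF sq]
      by (intro sum.cong refl h) (auto simp: residue_reps_val_ring ppow_diff_commute)
    also have "\<dots> = (\<Sum>z\<in>U. \<Sum>x\<in>{x \<in> U. residue_rep (d * x\<^sup>2) = z}. h (residue_rep (d * x\<^sup>2)))"
      by (rule sum.group[symmetric]) (use fin rU in auto)
    also have "\<dots> = (\<Sum>z\<in>U. of_nat (card {x \<in> U. residue_rep (d * x\<^sup>2) = z}) * h z)"
      by (intro sum.cong refl) simp
    finally show ?thesis .
  qed
  have "(\<Sum>x\<in>U. h (1 * x\<^sup>2)) + (\<Sum>x\<in>U. h (c * x\<^sup>2)) = (\<Sum>z\<in>U. 2 * h z)"
    unfolding fib[OF one_in_shell] fib[OF nonsquare_in_shell] sum.distrib[symmetric] distrib_right[symmetric]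
      of_nat_add[symmetric]
    by (intro sum.cong refl) (simp add: card_square_fibres[folded U_def])
  then show ?thesis
    unfolding split using V[OF one_in_val_ring] V[OF nonsquare_in_val_ring]
    by (simp add: algebra_simps flip: sum_distrib_left sum_distrib_right)
qed

text \<open>By the fibre count the class of \<open>x\<close> is hit by some y^2 or some c y^2. The
  former would make \<open>x\<close> a square; the latter makes \<open>c * x\<close> congruent to (c
  y)^2.\<close>

lemma unit_square_or_twisted_square:
  assumes x: "x \<in> shell 0" and "\<not> is_square x"
  shows "is_square (c * x)"
proof -
  define U where "U = residue_reps - (max_ideal :: 'a set)"
  have nonempty: "A \<noteq> {} \<or> B \<noteq> {}" if "card A + card B = 2" for A B :: "'a set"
    using that by auto
  have "residue_rep x \<in> U"
    unfolding U_def by (rule residue_rep_unit[OF x])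
  then have "card {y \<in> U. residue_rep (y\<^sup>2) = residue_rep x} +
      card {y \<in> U. residue_rep (c * y\<^sup>2) = residue_rep x} = 2"
    unfolding U_def by (rule card_square_fibres)
  then have "{y \<in> U. residue_rep (y\<^sup>2) = residue_rep x} \<noteq> {} \<or>
      {y \<in> U. residue_rep (c * y\<^sup>2) = residue_rep x} \<noteq> {}"
    by (rule nonempty)
  moreover have "residue_rep (y\<^sup>2) \<noteq> residue_rep x" if "y \<in> U" for y
  proof
    assume "residue_rep (y\<^sup>2) = residue_rep x"
    then have "y\<^sup>2 - x \<in> max_ideal"
      using that x by (subst (asm) residue_rep_cong_iff)
        (auto simp: U_def residue_reps_val_ring val_ring_power shell_subset_ppow)
    then show False
      using is_square_if_square_mod_max_ideal[OF char x, of y] assms(2)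
      by (simp add: ppow_diff_commute)
  qed
  ultimately obtain y where y: "y \<in> U" "residue_rep (c * y\<^sup>2) = residue_rep x"
    by blast
  have yO: "y\<^sup>2 \<in> val_ring"
    using y(1) by (auto simp: U_def intro: val_ring_power residue_reps_val_ring)
  have "c * y\<^sup>2 \<in> val_ring"
    using ppow_mult[OF nonsquare_in_val_ring yO] by simp
  then have "c * y\<^sup>2 - x \<in> max_ideal"
    using y(2) x by (subst (asm) residue_rep_cong_iff) (auto simp: shell_subset_ppow)
  then have "c * (x - c * y\<^sup>2) \<in> ppow (0 + 1)"
    using ppow_shell_cancel[OF nonsquare_in_shell, of "x - c * y\<^sup>2" 1] ppow_diff_commute[of x "c * y\<^sup>2"]
    by simp
  then have "c * x - (c * y)\<^sup>2 \<in> max_ideal"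
    by (simp add: power2_eq_square algebra_simps)
  then show ?thesis
    using is_square_if_square_mod_max_ideal[OF char, of "c * x" "c * y"]
      shell_mult[OF nonsquare_in_shell x] by simp
qed

text \<open>
  Otherwise the set of squares in the residue field would be stable under translation by \<open>- c\<close>,
  hence under translation by \<open>c\<close>, and \<open>c = 0 + c\<close> would be a square.
\<close>

lemma nonsquare_norm: "\<exists>a\<in>val_ring. a\<^sup>2 - c \<in> shell 0 \<and> \<not> is_square (a\<^sup>2 - c)"
proof (rule ccontr)
  assume contra: "\<not> ?thesis"
  define T :: "'a set" where "T = {r \<in> residue_reps. \<exists>y\<in>val_ring. r - y\<^sup>2 \<in> max_ideal}"
  let ?g = "\<lambda>r. residue_rep (r - c)"
  have T: "r \<in> val_ring" "r - c \<in> val_ring" if "r \<in> T" for r :: 'a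
    using that ppow_diff[OF residue_reps_val_ring nonsquare_in_val_ring]
    by (auto simp: T_def residue_reps_val_ring)
  \<comment> \<open>Since \<open>c\<close> is not a square modulo p, y^2 - c never vanishes modulo
    p.\<close>
  have unit: "y\<^sup>2 - c \<in> shell 0" if "y \<in> val_ring" for y
    using that c ppow_diff[OF val_ring_power[OF that, of 2] nonsquare_in_val_ring]
    by (auto simp: shell_eq lifts_nonsquare_def ppow_diff_commute)
  have "?g r \<in> T" if r: "r \<in> T" for r
  proof -
    obtain y where y: "y \<in> val_ring" "r - y\<^sup>2 \<in> max_ideal"
      using r by (auto simp: T_def)
    have "is_square (y\<^sup>2 - c)"
      using contra unit[OF y(1)] y(1) by blast
    then obtain z where z: "y\<^sup>2 - c = z\<^sup>2" by (auto simp: is_square_def)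
    then have zO: "z \<in> val_ring"
      using unit[OF y(1)] by (cases "z = 0") (auto simp: shell_def ppow_def vord_power)
    have "?g r - z\<^sup>2 = (?g r - (r - c)) + (r - y\<^sup>2)"
      by (simp add: algebra_simps flip: z)
    then have "?g r - z\<^sup>2 \<in> max_ideal"
      using ppow_add[OF residue_rep(2)[OF T(2)[OF r]] y(2)] by (simp only:)
    then show ?thesis
      using zO residue_rep(1)[OF T(2)[OF r]] by (auto simp: T_def)
  qed
  then have "?g ` T \<subseteq> T" by blast
  moreover have "inj_on ?g T"
  proof (rule inj_onI)
    fix r r' assume r: "r \<in> T" "r' \<in> T" "?g r = ?g r'"
    then have "r - c - (r' - c) \<in> max_ideal"
      by (subst (asm) residue_rep_cong_iff) (auto intro: T)
    then show "r = r'"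
      using r by (intro residue_reps_unique) (auto simp: T_def)
  qed
  moreover have "finite T" by (simp add: T_def)
  \<comment> \<open>An injective self-map of a finite set is onto; this is how stability under the
    inverse translation is obtained.\<close>
  ultimately have "?g ` T = T"
    using endo_inj_surj[of T ?g] by blast
  moreover have "residue_rep 0 \<in> T"
    using residue_rep[of "0::'a"] by (auto simp: T_def intro!: bexI[of _ 0])
  ultimately have "residue_rep 0 \<in> ?g ` T"
    by (simp only:)
  then obtain r where r: "r \<in> T" "residue_rep 0 = ?g r" ..
  then have "r - c \<in> max_ideal"
    using residue_rep_cong_iff[of "r - c" 0] T(2)[of r] by simp
  moreover obtain y where y: "y \<in> val_ring" "r - y\<^sup>2 \<in> max_ideal"
    using r(1) by (auto simp: T_def)
  ultimately have "c - y\<^sup>2 \<in> max_ideal"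
    using ppow_diff[of "r - y\<^sup>2" 1 "r - c"] by simp
  then show False
    using c y(1) by (simp add: lifts_nonsquare_def)
qed

end

section \<open>Quadratic characters\<close>

lemma quad_norm_mult: "quad_norm \<theta> (quad_mult \<theta> z w) = quad_norm \<theta> z * quad_norm \<theta> w"
  by (simp add: quad_norm_def quad_mult_def power2_eq_square algebra_simps)

text \<open>An element with non-zero norm is inverted by its conjugate divided by the norm. The
  argument is purely algebraic and covers square \<open>\<theta>\<close>, where the algebra is not a
  field.\<close>

lemma norm_group_iff: "x \<in> norm_group \<theta> \<longleftrightarrow> x \<noteq> 0 \<and> (\<exists>a b. x = a\<^sup>2 - b\<^sup>2 * \<theta>)"
proof
  assume "x \<in> norm_group \<theta>"
  then obtain z w where x: "x = quad_norm \<theta> z" and zw: "quad_mult \<theta> z w = (1, 0)"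
    by (auto simp: norm_group_def quad_units_def)
  have "x * quad_norm \<theta> w = 1"
    unfolding x quad_norm_mult[symmetric] zw by (simp add: quad_norm_def)
  then show "x \<noteq> 0 \<and> (\<exists>a b. x = a\<^sup>2 - b\<^sup>2 * \<theta>)"
    using x by (auto simp: quad_norm_def)
next
  assume "x \<noteq> 0 \<and> (\<exists>a b. x = a\<^sup>2 - b\<^sup>2 * \<theta>)"
  then obtain a b where x: "x \<noteq> 0" "x = a\<^sup>2 - b\<^sup>2 * \<theta>" by blast
  have "a * (a / x) + b * (- b / x) * \<theta> = (a\<^sup>2 - b\<^sup>2 * \<theta>) / x"
    by (simp add: diff_divide_distrib power2_eq_square)
  then have "quad_mult \<theta> (a, b) (a / x, - b / x) = (1, 0)"
    using x(1) by (simp add: quad_mult_def flip: x(2))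
  then have "(a, b) \<in> quad_units \<theta>"
    unfolding quad_units_def by blast
  then show "x \<in> norm_group \<theta>"
    unfolding norm_group_def using x(2) by (intro image_eqI[of _ _ "(a, b)"]) (simp_all add: quad_norm_def)
qed

lemma norm_group_mult_power2:
  assumes "x \<in> norm_group \<theta>" "a \<noteq> 0"
  shows "x * a\<^sup>2 \<in> norm_group \<theta>"
proof -
  obtain c d where cd: "x \<noteq> 0" "x = c\<^sup>2 - d\<^sup>2 * \<theta>"
    using assms(1) by (auto simp: norm_group_iff)
  have "x * a\<^sup>2 = (c * a)\<^sup>2 - (d * a)\<^sup>2 * \<theta>"
    by (simp add: cd(2) power2_eq_square algebra_simps)
  then show ?thesis
    using cd(1) assms(2) unfolding norm_group_iff by auto
qed

lemma norm_group_mult_power2_iff: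
  assumes "a \<noteq> 0"
  shows "x * a\<^sup>2 \<in> norm_group \<theta> \<longleftrightarrow> x \<in> norm_group \<theta>"
  using norm_group_mult_power2[of x \<theta> a] norm_group_mult_power2[of "x * a\<^sup>2" \<theta> "inverse a"] assms
  by (auto simp: field_simps)

lemma sgn_char_mult_power2: "a \<noteq> 0 \<Longrightarrow> sgn_char \<theta> (x * a\<^sup>2) = sgn_char \<theta> x"
  by (simp add: sgn_char_def norm_group_mult_power2_iff)

text \<open>Elements of 1 + p are squares, and multiplication by non-zero squares preserves each
  norm group; so this holds uniformly in \<open>\<theta>\<close>.\<close>

lemma sgn_char_perturb:
  fixes x y :: "'a::nonarch_local_field"
  assumes "residual_char_not_2 TYPE('a)" "x \<in> shell n" "y \<in> ppow (n + 1)"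
  shows "sgn_char \<theta> (x + y) = sgn_char \<theta> x"
proof -
  obtain w where "w \<noteq> 0" "x + y = x * w\<^sup>2"
    using perturbation_by_square[OF assms] by blast
  then show ?thesis by (simp add: sgn_char_mult_power2)
qed

lemma square_scaling_to_unit:
  fixes x :: "'a::nonarch_local_field"
  assumes "x \<noteq> 0" "even (vord x)"
  obtains a e where "a \<noteq> 0" "e \<in> shell 0" "x = e * a\<^sup>2"
proof -
  obtain a :: 'a where a: "a \<in> shell (vord x div 2)"
    by (rule shell_nonempty)
  have "x / a\<^sup>2 \<in> shell 0"
    using assms a by (auto simp: shell_def divide_inverse vord_mult vord_inverse vord_power)
  moreover have "x = x / a\<^sup>2 * a\<^sup>2"
    using shell_nonzero[OF a] by simp
  ultimately show thesis
    using that shell_nonzero[OF a] by blast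
qed

text \<open>On elements of even valuation this is the quadratic residue symbol of the unit part, and
  only there is it multiplicative; at odd valuation it is constantly -1.\<close>

definition square_char :: "'a::nonarch_local_field \<Rightarrow> complex" where
  "square_char x = (if is_square x then 1 else - 1)"

lemma square_char_mult_power2: "a \<noteq> 0 \<Longrightarrow> square_char (x * a\<^sup>2) = square_char x"
  by (simp add: square_char_def is_square_mult_power2_iff)

lemma is_square_unit_mult:
  fixes x y :: "'a::nonarch_local_field"
  assumes "residual_char_not_2 TYPE('a)" "x \<in> shell 0" "y \<in> shell 0"
  shows "is_square (x * y) \<longleftrightarrow> (is_square x \<longleftrightarrow> is_square y)"
proof -
  have one: "is_square (x * y) \<longleftrightarrow> is_square y" if x: "is_square x" "x \<in> shell 0" for x y :: 'a
  proof -
    obtain z where z: "x = z\<^sup>2" using x(1) by (auto simp: is_square_def)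
    then have "z \<noteq> 0" using shell_nonzero[OF x(2)] by auto
    then show ?thesis
      using is_square_mult_power2_iff[of z y] by (simp add: z mult.commute)
  qed
  consider "is_square x" | "is_square y" | "\<not> is_square x" "\<not> is_square y" by blast
  then show ?thesis
  proof cases
    case 1
    then show ?thesis using one[OF 1 assms(2)] by simp
  next
    case 2
    then show ?thesis using one[OF 2 assms(3), of x] by (simp add: mult.commute)
  next
    case 3
    \<comment> \<open>Now \<open>x\<close> itself takes the part of the fixed non-square, so its
      product with another non-square unit is a square.\<close>
    have "lifts_nonsquare x"
      using lifts_nonsquare_iff[OF assms(1,2)] 3(1) by simp
    then show ?thesis
      using unit_square_or_twisted_square[OF assms(1) _ assms(3) 3(2), of x] 3 by simp
  qed
qed

lemma square_char_mult:
  fixes x y :: "'a::nonarch_local_field"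
  assumes "residual_char_not_2 TYPE('a)" "x \<noteq> 0" "y \<noteq> 0" "even (vord x)" "even (vord y)"
  shows "square_char (x * y) = square_char x * square_char y"
proof -
  obtain a e where x: "a \<noteq> 0" "e \<in> shell 0" "x = e * a\<^sup>2"
    by (rule square_scaling_to_unit[OF assms(2,4)])
  obtain b f where y: "b \<noteq> 0" "f \<in> shell 0" "y = f * b\<^sup>2"
    by (rule square_scaling_to_unit[OF assms(3,5)])
  have "x * y = (e * f) * (a * b)\<^sup>2"
    by (simp add: x(3) y(3) power_mult_distrib)
  then have "square_char (x * y) = square_char (e * f)"
    using x(1) y(1) square_char_mult_power2[of "a * b" "e * f"] by simp
  also have "\<dots> = square_char e * square_char f"
    using is_square_unit_mult[OF assms(1) x(2) y(2)] by (simp add: square_char_def)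
  also have "square_char e = square_char x"
    using x(1) by (simp add: x(3) square_char_mult_power2)
  also have "square_char f = square_char y"
    using y(1) by (simp add: y(3) square_char_mult_power2)
  finally show ?thesis .
qed

section \<open>Closed forms of the unramified and ramified sign characters\<close>

lemma sgn_char_unramified:
  fixes x \<epsilon> :: "'a::nonarch_local_field"
  assumes char: "residual_char_not_2 TYPE('a)" and \<epsilon>: "lifts_nonsquare \<epsilon>" and x: "x \<noteq> 0"
  shows "sgn_char \<epsilon> x = (if even (vord x) then 1 else - 1)"
proof -
  have \<epsilon>0: "\<epsilon> \<in> shell 0" using \<epsilon> by (simp add: lifts_nonsquare_def)
  have "x \<in> norm_group \<epsilon> \<longleftrightarrow> even (vord x)"
  proof
    assume "x \<in> norm_group \<epsilon>"
    then obtain a b where ab: "x = a\<^sup>2 - b\<^sup>2 * \<epsilon>"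
      by (auto simp: norm_group_iff)
    show "even (vord x)"
    proof (cases "b = 0")
      case True
      then show ?thesis
        using ab x by (simp add: vord_power)
    next
      case False
      \<comment> \<open>Dividing out b^2 leaves z^2 - eps, which is a unit for integral
        \<open>z\<close> (eps is not a square modulo p) and otherwise is dominated by z^2.\<close>
      define z where "z = a / b"
      have xz: "x = b\<^sup>2 * (z\<^sup>2 - \<epsilon>)"
        using False by (simp add: ab z_def power_divide algebra_simps)
      have "even (vord (z\<^sup>2 - \<epsilon>))"
      proof (cases "z \<in> val_ring")
        case True
        then have "z\<^sup>2 - \<epsilon> \<in> val_ring" "z\<^sup>2 - \<epsilon> \<notin> max_ideal"
          using \<epsilon> ppow_diff[OF val_ring_power[OF True, of 2] shell_subset_ppow[OF \<epsilon>0]]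
          by (auto simp: lifts_nonsquare_def ppow_diff_commute)
        then have "z\<^sup>2 - \<epsilon> \<in> shell 0" by (simp add: shell_eq)
        then show ?thesis by (simp add: shell_def)
      next
        case False
        then have z: "z \<noteq> 0" "vord z < 0" by (auto simp: ppow_def)
        then have "z\<^sup>2 \<in> shell (2 * vord z)"
          by (simp add: shell_def vord_power)
        then have "z\<^sup>2 + (- \<epsilon>) \<in> shell (2 * vord z)"
          by (rule shell_add_le[of _ _ _ 0]) (use \<epsilon>0 z in \<open>auto simp: shell_eq\<close>)
        then show ?thesis by (simp add: shell_def)
      qed
      then show ?thesis
        using x False by (auto simp: xz vord_mult vord_power)
    qed
  next
    assume "even (vord x)"
    then obtain a e where e: "a \<noteq> 0" "e \<in> shell 0" "x = e * a\<^sup>2"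
      by (rule square_scaling_to_unit[OF x])
    have "e \<in> norm_group \<epsilon>"
    proof (cases "is_square e")
      case True
      then obtain y where "e = y\<^sup>2 - 0\<^sup>2 * \<epsilon>" by (auto simp: is_square_def)
      then show ?thesis
        using shell_nonzero[OF e(2)] unfolding norm_group_iff by blast
    next
      case False
      \<comment> \<open>Square units are norms already; this norm represents the other square class
        of units, so \<open>e\<close> differs from it by a square factor.\<close>
      obtain b where b: "b \<in> val_ring" "b\<^sup>2 - \<epsilon> \<in> shell 0" "\<not> is_square (b\<^sup>2 - \<epsilon>)"
        using nonsquare_norm[OF char \<epsilon>] by blast
      have "b\<^sup>2 - \<epsilon> = b\<^sup>2 - 1\<^sup>2 * \<epsilon>" by simp
      then have N: "b\<^sup>2 - \<epsilon> \<in> norm_group \<epsilon>"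
        using shell_nonzero[OF b(2)] unfolding norm_group_iff by blast
      have "is_square (e * (b\<^sup>2 - \<epsilon>))"
        using is_square_unit_mult[OF char e(2) b(2)] False b(3) by simp
      then obtain y where y: "e * (b\<^sup>2 - \<epsilon>) = y\<^sup>2"
        by (auto simp: is_square_def)
      have "e = (b\<^sup>2 - \<epsilon>) * (y / (b\<^sup>2 - \<epsilon>))\<^sup>2"
        unfolding power_divide y[symmetric] using shell_nonzero[OF b(2)]
        by (simp add: power2_eq_square[of "b\<^sup>2 - \<epsilon>"])
      moreover have "y \<noteq> 0"
        using y shell_nonzero[OF e(2)] shell_nonzero[OF b(2)] by auto
      ultimately show ?thesis
        using norm_group_mult_power2[OF N, of "y / (b\<^sup>2 - \<epsilon>)"] shell_nonzero[OF b(2)] by simp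
    qed
    then show "x \<in> norm_group \<epsilon>"
      unfolding e(3) by (rule norm_group_mult_power2[OF _ e(1)])
  qed
  then show ?thesis by (simp add: sgn_char_def)
qed

lemma uniformiser_shell: "uniformiser w \<longleftrightarrow> w \<in> shell 1"
  by (simp add: uniformiser_def shell_def)

text \<open>In a^2 - b^2 w the two terms have valuations of opposite parity, so the dominant one
  fixes the square class: that of 1 or that of -w. Conversely -w is the norm of sqrt w.\<close>

lemma norm_group_uniformiser:
  fixes x w :: "'a::nonarch_local_field"
  assumes char: "residual_char_not_2 TYPE('a)" and w: "uniformiser w" and x: "x \<noteq> 0"
  shows "x \<in> norm_group w \<longleftrightarrow> is_square x \<or> is_square (- w * x)"
proof
  have w0: "w \<noteq> 0" "vord w = 1" using w by (auto simp: uniformiser_def)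
  assume "x \<in> norm_group w"
  then obtain a b where ab: "x = a\<^sup>2 - b\<^sup>2 * w"
    by (auto simp: norm_group_iff)
  consider "b = 0" | "b \<noteq> 0" "a = 0" | "b \<noteq> 0" "a \<noteq> 0" "vord a \<le> vord b"
    | "b \<noteq> 0" "a \<noteq> 0" "vord b < vord a"
    by linarith
  then show "is_square x \<or> is_square (- w * x)"
  proof cases
    case 1
    then show ?thesis by (simp add: ab)
  next
    case 2
    then have "- w * x = (b * w)\<^sup>2"
      by (simp add: ab power2_eq_square algebra_simps)
    then show ?thesis by (simp only: is_square_power2 simp_thms)
  next
    case 3
    have "a\<^sup>2 \<in> shell (2 * vord a)" "- (b\<^sup>2 * w) \<in> ppow (2 * vord a + 1)"
      using 3 w0 by (auto simp: shell_def ppow_def vord_power vord_mult)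
    then obtain z where "z \<noteq> 0" "a\<^sup>2 + - (b\<^sup>2 * w) = a\<^sup>2 * z\<^sup>2"
      using perturbation_by_square[OF char] by blast
    then have "x = (a * z)\<^sup>2"
      by (simp add: ab power_mult_distrib)
    then show ?thesis by simp
  next
    case 4
    have "- (b\<^sup>2 * w) \<in> shell (2 * vord b + 1)" "a\<^sup>2 \<in> ppow (2 * vord b + 1 + 1)"
      using 4 w0 by (auto simp: shell_def ppow_def vord_power vord_mult)
    then obtain z where "z \<noteq> 0" "- (b\<^sup>2 * w) + a\<^sup>2 = - (b\<^sup>2 * w) * z\<^sup>2"
      using perturbation_by_square[OF char] by blast
    then have "- w * x = - w * (- (b\<^sup>2 * w) * z\<^sup>2)"
      by (simp add: ab)
    also have "\<dots> = (w * b * z)\<^sup>2"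
      by (simp add: power2_eq_square)
    finally have "- w * x = (w * b * z)\<^sup>2" .
    then show ?thesis by (simp only: is_square_power2 simp_thms)
  qed
next
  have w0: "w \<noteq> 0" using w by (auto simp: uniformiser_def)
  assume "is_square x \<or> is_square (- w * x)"
  then consider y where "x = y\<^sup>2" | y where "- w * x = y\<^sup>2"
    by (auto simp: is_square_def)
  then show "x \<in> norm_group w"
  proof cases
    case (1 y)
    then have "x = y\<^sup>2 - 0\<^sup>2 * w" by simp
    then show ?thesis using x unfolding norm_group_iff by blast
  next
    case (2 y)
    then have "x = - (y\<^sup>2) / w"
      using w0 by (simp add: field_simps flip: 2)
    then have "x = 0\<^sup>2 - (y / w)\<^sup>2 * w"
      using w0 by (simp add: power2_eq_square)
    then show ?thesis using x unfolding norm_group_iff by blast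
  qed
qed

text \<open>Parity of the valuation leaves only one alternative of
  \<open>norm_group_uniformiser\<close> open. Multiplication by the norm -w moves odd valuations to
  even ones, where \<open>square_char\<close> is the residue symbol.\<close>

lemma sgn_char_uniformiser:
  fixes x w :: "'a::nonarch_local_field"
  assumes "residual_char_not_2 TYPE('a)" "uniformiser w" "x \<noteq> 0"
  shows "sgn_char w x = (if even (vord x) then square_char x else square_char (- w * x))"
proof -
  have w: "w \<noteq> 0" "vord w = 1" using assms(2) by (auto simp: uniformiser_def)
  have "vord (- w * x) = 1 + vord x"
    using w assms(3) by (simp add: vord_mult)
  then have "\<not> is_square (- w * x)" if "even (vord x)"
    using even_vord_square[of "- w * x"] that w assms(3) by auto
  moreover have "\<not> is_square x" if "odd (vord x)"
    using even_vord_square[of x] that assms(3) by auto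
  ultimately show ?thesis
    using norm_group_uniformiser[OF assms] by (auto simp: sgn_char_def square_char_def)
qed

lemma sgn_char_uniformiser_mult:
  fixes x y w :: "'a::nonarch_local_field"
  assumes "residual_char_not_2 TYPE('a)" "uniformiser w" "x \<noteq> 0" "y \<noteq> 0"
  shows "sgn_char w (x * y) = sgn_char w x * sgn_char w y"
proof -
  have w: "w \<noteq> 0" "vord w = 1" using assms(2) by (auto simp: uniformiser_def)
  \<comment> \<open>Multiplying by the norm -w where necessary reaches the domain on which
    \<open>square_char\<close> is multiplicative. Two odd factors produce a surplus (-w)^2, which is
    harmless.\<close>
  define even_part where "even_part = (\<lambda>z::'a. if even (vord z) then z else - w * z)"
  have sgn: "sgn_char w z = square_char (even_part z)" if "z \<noteq> 0" for z
    using sgn_char_uniformiser[OF assms(1,2) that] by (simp add: even_part_def)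
  have ev: "even_part z \<noteq> 0" "even (vord (even_part z))" if "z \<noteq> 0" for z
    using that w by (auto simp: even_part_def vord_mult)
  have "square_char (even_part (x * y)) = square_char (even_part x * even_part y)"
  proof (cases "odd (vord x) \<and> odd (vord y)")
    case True
    then have "even_part x * even_part y = even_part (x * y) * w\<^sup>2"
      using assms(3,4) by (simp add: even_part_def vord_mult power2_eq_square)
    then show ?thesis using w by (simp add: square_char_mult_power2)
  next
    case False
    then have "even_part x * even_part y = even_part (x * y)"
      using assms(3,4) by (auto simp: even_part_def vord_mult)
    then show ?thesis by simp
  qed
  then show ?thesis
    using assms(3,4) ev by (simp add: sgn square_char_mult[OF assms(1)])
qed

text \<open>At odd valuation the two ramified characters are residue symbols of -eps w x and -w x.
  These differ by the non-square unit eps, which produces the sign sgn_eps(x); at even valuation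
  both test \<open>x\<close> itself.\<close>

lemma sgn_char_unramified_mult_uniformiser:
  fixes x w \<epsilon> :: "'a::nonarch_local_field"
  assumes char: "residual_char_not_2 TYPE('a)" and \<epsilon>: "lifts_nonsquare \<epsilon>"
    and w: "uniformiser w" and x: "x \<noteq> 0"
  shows "sgn_char (\<epsilon> * w) x = sgn_char \<epsilon> x * sgn_char w x"
proof -
  have \<epsilon>0: "\<epsilon> \<in> shell 0" using \<epsilon> by (simp add: lifts_nonsquare_def)
  have w0: "w \<noteq> 0" "vord w = 1" using w by (auto simp: uniformiser_def)
  have ew: "uniformiser (\<epsilon> * w)"
    using shell_mult[OF \<epsilon>0, of w 1] w by (simp add: uniformiser_shell)
  show ?thesis
  proof (cases "even (vord x)")
    case True
    then show ?thesis
      using sgn_char_uniformiser[OF char ew x] sgn_char_uniformiser[OF char w x]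
        sgn_char_unramified[OF char \<epsilon> x] by simp
  next
    case False
    have "- (\<epsilon> * w) * x = \<epsilon> * (- w * x)" by simp
    then have "square_char (- (\<epsilon> * w) * x) = square_char \<epsilon> * square_char (- w * x)"
      using False \<epsilon>0 w0 x square_char_mult[OF char, of \<epsilon> "- w * x"]
      by (simp only:) (auto simp: vord_mult shell_def)
    moreover have "square_char \<epsilon> = - 1"
      using lifts_nonsquare_iff[OF char \<epsilon>0] \<epsilon> by (simp add: square_char_def)
    ultimately show ?thesis
      using False sgn_char_uniformiser[OF char ew x] sgn_char_uniformiser[OF char w x]
        sgn_char_unramified[OF char \<epsilon> x] by simp
  qed
qed

section \<open>Additive characters\<close>

text \<open>The absence of small subgroups: w^2 - 1 = (w + 1)(w - 1) with |w + 1| at least 3/2, so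
  each squaring enlarges the distance to 1 by a factor of at least 3/2, and only z = 1 can stay
  close for ever.\<close>

lemma eq_1_if_powers_near_1:
  fixes z :: complex
  assumes "\<And>k. norm (z ^ (2 ^ k) - 1) < 1 / 2"
  shows "z = 1"
proof (rule ccontr)
  assume "z \<noteq> 1"
  then have pos: "0 < norm (z - 1)" by simp
  have grow: "(3 / 2) ^ k * norm (z - 1) \<le> norm (z ^ (2 ^ k) - 1)" for k
  proof (induction k)
    case (Suc k)
    define w where "w = z ^ (2 ^ k)"
    have "norm (2 :: complex) \<le> norm (w + 1) + norm (w - 1)"
      using norm_triangle_ineq4[of "w + 1" "w - 1"] by simp
    then have w1: "3 / 2 \<le> norm (w + 1)"
      using assms[of k] by (simp add: w_def)
    have "(3 / 2) ^ Suc k * norm (z - 1) = 3 / 2 * ((3 / 2) ^ k * norm (z - 1))"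
      by simp
    also have "\<dots> \<le> norm (w + 1) * norm (w - 1)"
      using w1 Suc by (intro mult_mono) (auto simp: w_def)
    also have "\<dots> = norm ((w + 1) * (w - 1))"
      by (simp add: norm_mult)
    also have "(w + 1) * (w - 1) = z ^ (2 ^ Suc k) - 1"
      by (simp add: w_def power_mult algebra_simps power2_eq_square flip: power_add)
    finally show ?case .
  qed simp
  obtain k where "1 / norm (z - 1) < (3 / 2) ^ k"
    using real_arch_pow[of "3 / 2" "1 / norm (z - 1)"] by auto
  then have "1 < (3 / 2) ^ k * norm (z - 1)"
    using pos by (simp add: field_simps)
  then show False
    using grow[of k] assms[of k] by linarith
qed

lemma additive_character_add: "additive_character \<Psi> \<Longrightarrow> \<Psi> (x + y) = \<Psi> x * \<Psi> y"
  by (simp add: additive_character_def)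

lemma norm_additive_character: "additive_character \<Psi> \<Longrightarrow> norm (\<Psi> x) = 1"
  by (simp add: additive_character_def)

lemma additive_character_0:
  assumes "additive_character \<Psi>"
  shows "\<Psi> 0 = 1"
proof -
  have "\<Psi> 0 \<noteq> 0"
    using norm_additive_character[OF assms, of 0] by auto
  moreover have "\<Psi> 0 = \<Psi> 0 * \<Psi> 0"
    using additive_character_add[OF assms, of 0 0] by simp
  ultimately show ?thesis by simp
qed

lemma additive_character_perturb:
  assumes "additive_character \<Psi>" "\<And>z. z \<in> ppow n \<Longrightarrow> \<Psi> z = 1" "x - y \<in> ppow n"
  shows "\<Psi> x = \<Psi> y"
  using additive_character_add[OF assms(1), of "x - y" y] assms(2)[OF assms(3)] by simp

text \<open>By continuity some fractional ideal is mapped into a small ball around 1. Its image is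
  closed under powers, hence trivial.\<close>

lemma additive_character_locally_trivial:
  fixes \<Psi> :: "'a::nonarch_local_field \<Rightarrow> complex"
  assumes "additive_character \<Psi>"
  obtains n where "\<And>x. x \<in> ppow n \<Longrightarrow> \<Psi> x = 1"
proof -
  have "continuous_on UNIV \<Psi>"
    using assms by (simp add: additive_character_def)
  then have "open (\<Psi> -` ball 1 (1 / 2))"
    using continuous_on_open_vimage[OF open_UNIV] open_ball by fastforce
  moreover have "0 \<in> \<Psi> -` ball 1 (1 / 2)"
    by (simp add: additive_character_0[OF assms])
  ultimately obtain n where n: "\<And>y. y \<in> ppow n \<Longrightarrow> 0 + y \<in> \<Psi> -` ball 1 (1 / 2)"
    using open_ppow_nbhd by blast
  show thesis
  proof (rule that)
    fix x :: 'a assume x: "x \<in> ppow n"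
    have pow: "\<exists>y\<in>ppow n. \<Psi> y = \<Psi> x ^ m" for m
    proof (induction m)
      case 0
      show ?case
        by (rule bexI[of _ 0]) (simp_all add: additive_character_0[OF assms])
    next
      case (Suc m)
      then obtain y where "y \<in> ppow n" "\<Psi> y = \<Psi> x ^ m" by blast
      then show ?case
        using x by (intro bexI[of _ "x + y"])
          (simp_all add: additive_character_add[OF assms] ppow_add)
    qed
    show "\<Psi> x = 1"
    proof (rule eq_1_if_powers_near_1)
      fix k :: nat
      obtain y where y: "y \<in> ppow n" "\<Psi> y = \<Psi> x ^ (2 ^ k)"
        using pow by blast
      have "dist 1 (\<Psi> y) < 1 / 2"
        using n[OF y(1)] by simp
      then show "norm (\<Psi> x ^ (2 ^ k) - 1) < 1 / 2"
        by (simp add: dist_norm norm_minus_commute flip: y(2))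
    qed
  qed
qed

lemma depth_properties:
  fixes \<Psi> :: "'a::nonarch_local_field \<Rightarrow> complex"
  assumes "nontrivial_additive_character \<Psi>"
  shows trivial_above_depth: "x \<in> ppow (depth \<Psi> + 1) \<Longrightarrow> \<Psi> x = 1"
    and nontrivial_at_depth: "\<exists>x\<in>ppow (depth \<Psi>). \<Psi> x \<noteq> 1"
proof -
  have \<Psi>: "additive_character \<Psi>"
    using assms by (simp add: nontrivial_additive_character_def)
  obtain x0 where x0: "\<Psi> x0 \<noteq> 1"
    using assms by (auto simp: nontrivial_additive_character_def)
  then have x00: "x0 \<noteq> 0"
    using additive_character_0[OF \<Psi>] by auto
  obtain n where n: "\<And>x. x \<in> ppow n \<Longrightarrow> \<Psi> x = 1"
    using additive_character_locally_trivial[OF \<Psi>] by blast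
  define P where "P = (\<lambda>i. \<forall>x\<in>ppow (i + 1). \<Psi> x = 1)"
  \<comment> \<open>A \<open>LEAST\<close> over the integers is only meaningful with a lower bound
    on the candidates. Any ideal containing \<open>x0\<close> is excluded, so shifting by
    \<open>b\<close> reduces the question to natural numbers.\<close>
  define b where "b = vord x0"
  have Pb: "b \<le> i" if "P i" for i
  proof (rule ccontr)
    assume "\<not> b \<le> i"
    then have "x0 \<in> ppow (i + 1)"
      using x00 by (simp add: ppow_iff b_def)
    then show False using that x0 by (simp add: P_def)
  qed
  have "P (n - 1)" using n by (simp add: P_def)
  then have "P (b + int (nat (n - 1 - b)))"
    using Pb[of "n - 1"] by simp
  then have ex: "\<exists>k. P (b + int k)" by blast
  define i where "i = b + int (LEAST k. P (b + int k))"
  have Pi: "P i"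
    unfolding i_def using LeastI_ex[OF ex] .
  have min: "i \<le> j" if "P j" for j
  proof -
    have "P (b + int (nat (j - b)))"
      using that Pb[OF that] by simp
    then have "(LEAST k. P (b + int k)) \<le> nat (j - b)"
      by (rule Least_le)
    then show ?thesis
      using Pb[OF that] by (simp add: i_def)
  qed
  have d: "depth \<Psi> = i"
    unfolding depth_def P_def[symmetric] by (rule Least_equality) (use Pi min in auto)
  show "x \<in> ppow (depth \<Psi> + 1) \<Longrightarrow> \<Psi> x = 1"
    using Pi by (simp add: d P_def)
  have "\<not> P (i - 1)"
    using min[of "i - 1"] by auto
  then show "\<exists>x\<in>ppow (depth \<Psi>). \<Psi> x \<noteq> 1"
    by (simp add: d P_def)
qed

lemma nontrivial_scale_char:
  assumes "nontrivial_additive_character \<Psi>" "b \<noteq> 0"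
  shows "nontrivial_additive_character (scale_char \<Psi> b)"
proof -
  have \<Psi>: "additive_character \<Psi>"
    using assms by (simp add: nontrivial_additive_character_def)
  obtain x where "\<Psi> x \<noteq> 1"
    using assms by (auto simp: nontrivial_additive_character_def)
  then have "\<exists>x. scale_char \<Psi> b x \<noteq> 1"
    using assms(2) by (intro exI[of _ "x / b"]) (simp add: scale_char_def)
  moreover have "continuous_on UNIV (scale_char \<Psi> b)"
    unfolding scale_char_def
    using \<Psi> continuous_on_compose2[OF _ continuous_mult_const[of b], of UNIV \<Psi>]
    by (simp add: additive_character_def)
  ultimately show ?thesis
    using \<Psi> by (simp add: nontrivial_additive_character_def additive_character_def)
      (simp add: scale_char_def distrib_left)
qed

lemma sum_character_scaled_reps:
  fixes \<Psi> :: "'a::nonarch_local_field \<Rightarrow> complex"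
  assumes \<Psi>: "additive_character \<Psi>" and triv: "\<And>x. x \<in> ppow (r + 1) \<Longrightarrow> \<Psi> x = 1"
    and nontriv: "\<exists>x\<in>ppow r. \<Psi> x \<noteq> 1" and b: "b \<in> shell r"
  shows "(\<Sum>x\<in>residue_reps. \<Psi> (b * x)) = 0"
proof -
  obtain x where x: "x \<in> ppow r" "\<Psi> x \<noteq> 1" using nontriv by blast
  have "b * (x / b) = x"
    using shell_nonzero[OF b] by simp
  then show ?thesis
    using x ppow_div_shell[OF b x(1)] ppow_mult[OF shell_subset_ppow[OF b], of _ 1]
    by (intro sum_residue_reps_character[of _ "x / b"])
      (auto simp: additive_character_add[OF \<Psi>] distrib_left triv)
qed

section \<open>Haar measure\<close>

text \<open>Gives content to the invariance clause of \<open>normalised_haar\<close>: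
  \<open>distr\<close> is a genuine push-forward only along measurable maps.\<close>

lemma borel_measurable_translate: "(\<lambda>x. a + x) \<in> borel_measurable (borel :: 'a::nonarch_local_field measure)"
proof (rule borel_measurableI)
  fix S :: "'a set" assume S: "open S"
  have "open ((\<lambda>x. a + x) -` S)"
    unfolding open_iff_vord
  proof
    fix x assume "x \<in> (\<lambda>x. a + x) -` S"
    then have "a + x \<in> S" by simp
    then obtain n where n: "\<And>y. y \<in> ppow n \<Longrightarrow> a + x + y \<in> S"
      using open_ppow_nbhd[OF S] by blast
    show "\<exists>n. \<forall>y. y \<noteq> x \<longrightarrow> n \<le> vord (y - x) \<longrightarrow> y \<in> (\<lambda>x. a + x) -` S"
    proof (intro exI[of _ n] allI impI)
      fix y assume "y \<noteq> x" "n \<le> vord (y - x)"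
      then show "y \<in> (\<lambda>x. a + x) -` S"
        using n[of "y - x"] by (simp add: ppow_iff algebra_simps)
    qed
  qed
  then show "(\<lambda>x. a + x) -` S \<inter> space borel \<in> sets borel" by simp
qed

text \<open>The truncated function is invariant under one fractional ideal, so the preimage of every
  set is open. In the maximum, \<open>j\<close> preserves \<open>g\<close> and \<open>n + 1\<close>
  preserves the shell.\<close>

lemma borel_measurable_on_shell:
  fixes g :: "'a::nonarch_local_field \<Rightarrow> complex"
  assumes g: "\<And>x y. x \<in> shell n \<Longrightarrow> y \<in> ppow j \<Longrightarrow> g (x + y) = g x"
  shows "(\<lambda>x. indicator (shell n) x *\<^sub>R g x) \<in> borel_measurable borel"
proof (rule borel_measurableI)
  fix S :: "complex set"
  let ?h = "\<lambda>x. indicator (shell n) x *\<^sub>R g x"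
  have h: "?h (x + y) = ?h x" if "y \<in> ppow (max j (n + 1))" for x y
  proof (cases "x \<in> shell n")
    case True
    then show ?thesis
      using g[OF True, of y] shell_add[OF True, of y] ppow_mono[OF that] by simp
  next
    case False
    then have "x + y \<notin> shell n"
      using shell_add_iff[of y n x] ppow_mono[OF that] by simp
    then show ?thesis using False by simp
  qed
  have "open (?h -` S)"
    by (rule stable_imp_open[of _ "max j (n + 1)"]) (simp add: h)
  then show "?h -` S \<inter> space borel \<in> sets borel" by simp
qed

abbreviation (input) residue_q :: "'a::nonarch_local_field itself \<Rightarrow> real" where
  "residue_q T \<equiv> real (residue_card T)"

lemma residue_q_gt_1: "1 < residue_q TYPE('a::nonarch_local_field)"
  using residue_card_ge_2[where ?'a = 'a] by simp

lemma absv_shell: "x \<in> shell n \<Longrightarrow> absv x = residue_q TYPE('a) powi (- n)" for x :: "'a::nonarch_local_field"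
  by (simp add: absv_def shell_def)

text \<open>The fibres are {0} and the shells, and there are countably many of them.\<close>

lemma borel_measurable_absv: "(absv :: 'a::nonarch_local_field \<Rightarrow> real) \<in> borel_measurable borel"
proof (rule borel_measurableI)
  fix S :: "real set"
  have "closed {0 :: 'a}"
    unfolding closed_def open_iff_vord
  proof
    fix x :: 'a assume x: "x \<in> - {0}"
    show "\<exists>n. \<forall>y. y \<noteq> x \<longrightarrow> n \<le> vord (y - x) \<longrightarrow> y \<in> - {0}"
      using x by (intro exI[of _ "vord x + 1"]) auto
  qed
  then have "{x :: 'a. x = 0 \<and> 0 \<in> S} \<in> sets borel"
    by (cases "0 \<in> S") auto
  moreover have "(\<Union>n\<in>{n. residue_q TYPE('a) powi (- n) \<in> S}. shell n :: 'a set) \<in> sets borel"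
    by (intro sets.countable_UN') (auto intro: borel_open open_shell)
  moreover have "absv -` S = {x :: 'a. x = 0 \<and> 0 \<in> S} \<union>
      (\<Union>n\<in>{n. residue_q TYPE('a) powi (- n) \<in> S}. shell n)"
    by (auto simp: absv_def shell_def split: if_splits)
  ultimately show "absv -` S \<inter> space borel \<in> sets (borel :: 'a measure)"
    by simp
qed

section \<open>Volumes of fractional ideals and integrals over shells\<close>

context
  fixes \<mu> :: "'a::nonarch_local_field measure"
  assumes haar: "normalised_haar \<mu>"
begin

lemma sets_haar: "sets \<mu> = sets borel"
  using haar by (simp add: normalised_haar_def)

lemma space_haar: "space \<mu> = UNIV"
  using sets_eq_imp_space_eq[OF sets_haar] by simp

lemma borel_measurable_haar: "borel_measurable \<mu> = borel_measurable borel"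
  by (rule measurable_cong_sets[OF sets_haar refl])

lemma translate_measurable: "(\<lambda>x. a + x) \<in> measurable \<mu> borel"
  using borel_measurable_translate[of a] by (simp add: borel_measurable_haar)

lemma distr_haar: "distr \<mu> borel (\<lambda>x. a + x) = \<mu>"
  using haar by (simp add: normalised_haar_def)

lemma open_in_sets_haar: "open A \<Longrightarrow> A \<in> sets \<mu>"
  by (simp add: sets_haar)

lemma emeasure_coset: "emeasure \<mu> {x. x - a \<in> ppow n} = emeasure \<mu> (ppow n)"
proof -
  have "emeasure \<mu> {x. x - a \<in> ppow n} = emeasure (distr \<mu> borel (\<lambda>x. a + x)) {x. x - a \<in> ppow n}"
    by (simp add: distr_haar)
  also have "\<dots> = emeasure \<mu> ((\<lambda>x. a + x) -` {x. x - a \<in> ppow n} \<inter> space \<mu>)"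
    by (rule emeasure_distr[OF translate_measurable]) (simp add: open_ppow_coset)
  also have "(\<lambda>x. a + x) -` {x. x - a \<in> ppow n} \<inter> space \<mu> = ppow n"
    by (auto simp: space_haar)
  finally show ?thesis .
qed

lemma integral_translate:
  fixes h :: "'a \<Rightarrow> complex"
  assumes "h \<in> borel_measurable borel"
  shows "(\<integral>x. h (a + x) \<partial>\<mu>) = (\<integral>x. h x \<partial>\<mu>)"
  using integral_distr[OF translate_measurable assms, of a] by (simp add: distr_haar)

lemma integrable_translate:
  fixes h :: "'a \<Rightarrow> complex"
  assumes "h \<in> borel_measurable borel" "integrable \<mu> h"
  shows "integrable \<mu> (\<lambda>x. h (a + x))"
  using integrable_distr_eq[OF translate_measurable assms(1), of a] assms(2) by (simp add: distr_haar)

lemma ppow_eq_Union_cosets: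
  fixes c :: 'a
  assumes c: "c \<in> shell n"
  shows "ppow n = (\<Union>y\<in>residue_reps. {x. x - c * y \<in> ppow (n + 1)})"
    and "disjoint_family_on (\<lambda>y. {x. x - c * y \<in> ppow (n + 1)}) residue_reps"
proof -
  show "ppow n = (\<Union>y\<in>residue_reps. {x. x - c * y \<in> ppow (n + 1)})"
  proof (intro equalityI subsetI)
    fix x :: 'a assume "x \<in> ppow n"
    then have xc: "x / c \<in> val_ring"
      using ppow_div_shell[OF c] by fastforce
    note r = residue_rep[OF xc]
    have "c * (x / c - residue_rep (x / c)) \<in> ppow (n + 1)"
      using r(2) ppow_shell_cancel[OF c] by (subst ppow_shell_cancel[OF c]) (simp add: ppow_diff_commute)
    moreover have "c * (x / c - residue_rep (x / c)) = x - c * residue_rep (x / c)"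
      using shell_nonzero[OF c] by (simp add: right_diff_distrib)
    ultimately show "x \<in> (\<Union>y\<in>residue_reps. {x. x - c * y \<in> ppow (n + 1)})"
      using r(1) by auto
  next
    fix x assume "x \<in> (\<Union>y\<in>residue_reps. {x. x - c * y \<in> ppow (n + 1)})"
    then obtain y where y: "y \<in> residue_reps" "x - c * y \<in> ppow (n + 1)" by blast
    have "c * y \<in> ppow n"
      using ppow_mult[OF shell_subset_ppow[OF c] residue_reps_val_ring[OF y(1)]] by simp
    moreover have "x - c * y \<in> ppow n"
      using y(2) by (rule ppow_mono) simp
    ultimately show "x \<in> ppow n"
      using ppow_add[of "x - c * y" n "c * y"] by simp
  qed
  show "disjoint_family_on (\<lambda>y. {x. x - c * y \<in> ppow (n + 1)}) residue_reps"
    unfolding disjoint_family_on_def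
  proof (intro ballI impI)
    fix y z :: 'a assume yz: "y \<in> residue_reps" "z \<in> residue_reps" "y \<noteq> z"
    show "{x. x - c * y \<in> ppow (n + 1)} \<inter> {x. x - c * z \<in> ppow (n + 1)} = {}"
    proof (rule ccontr)
      assume "\<not> ?thesis"
      then obtain x where x: "x - c * y \<in> ppow (n + 1)" "x - c * z \<in> ppow (n + 1)" by blast
      have "c * (y - z) \<in> ppow (n + 1)"
        using ppow_diff[OF x(2,1)] by (simp add: algebra_simps)
      then have "y - z \<in> max_ideal"
        by (simp only: ppow_shell_cancel[OF c])
      then show False
        using residue_reps_unique[OF yz(1,2)] yz(3) by simp
    qed
  qed
qed

lemma emeasure_ppow_step:
  "emeasure \<mu> (ppow n) = of_nat (residue_card TYPE('a)) * emeasure \<mu> (ppow (n + 1))"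
proof -
  obtain c :: 'a where c: "c \<in> shell n" by (rule shell_nonempty)
  have "emeasure \<mu> (ppow n) = (\<Sum>y\<in>residue_reps. emeasure \<mu> {x. x - c * y \<in> ppow (n + 1)})"
    unfolding ppow_eq_Union_cosets(1)[OF c]
    by (rule sum_emeasure[symmetric])
      (auto intro: open_in_sets_haar open_ppow_coset ppow_eq_Union_cosets(2)[OF c])
  then show ?thesis
    by (simp add: emeasure_coset card_residue_reps)
qed

text \<open>The decomposition into q cosets is a recursion that runs in both directions from the
  normalised volume of the valuation ring. Passing to smaller ideals divides by q in the extended
  reals, which is legitimate because q is finite and non-zero.\<close>

lemma emeasure_ppow: "emeasure \<mu> (ppow n) = ennreal (residue_q TYPE('a) powi (- n))"
proof -
  let ?q = "residue_q TYPE('a)"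
  have q: "1 < ?q" by (rule residue_q_gt_1)
  have q': "of_nat (residue_card TYPE('a)) = ennreal ?q"
    by (simp add: ennreal_of_nat_eq_real_of_nat)
  have down: "emeasure \<mu> (ppow n) = ennreal (?q powi (- n))"
    if "emeasure \<mu> (ppow (n + 1)) = ennreal (?q powi (- (n + 1)))" for n
  proof -
    have "?q * ?q powi (- (n + 1)) = ?q powi (- n)"
      using q power_int_add[of ?q 1 "- (n + 1)"] by simp
    then show ?thesis
      unfolding emeasure_ppow_step[of n] that q' using q
      by (simp add: ennreal_mult[symmetric])
  qed
  have up: "emeasure \<mu> (ppow (n + 1)) = ennreal (?q powi (- (n + 1)))"
    if "emeasure \<mu> (ppow n) = ennreal (?q powi (- n))" for n
  proof -
    have "ennreal (?q powi (- (n + 1))) = ennreal (?q powi (- n)) / ennreal ?q"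
      using q power_int_add[of ?q "- (n + 1)" 1] by (simp add: divide_ennreal)
    also have "\<dots> = ennreal ?q * emeasure \<mu> (ppow (n + 1)) / ennreal ?q"
      unfolding that[symmetric] emeasure_ppow_step[of n] q' ..
    also have "\<dots> = emeasure \<mu> (ppow (n + 1))"
      using q by (subst mult.commute) (intro ennreal_mult_divide_eq, auto)
    finally show ?thesis ..
  qed
  show ?thesis
  proof (induction n rule: int_induct[where k = 0])
    case base
    show ?case using haar by (simp add: normalised_haar_def)
  next
    case (step1 i)
    then show ?case using up by simp
  next
    case (step2 i)
    then show ?case using down[of "i - 1"] by simp
  qed
qed

lemma measure_ppow: "measure \<mu> (ppow n) = residue_q TYPE('a) powi (- n)"
  using residue_q_gt_1 by (simp add: measure_def emeasure_ppow)

lemma measure_coset: "measure \<mu> {x. x - a \<in> ppow n} = residue_q TYPE('a) powi (- n)"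
  using residue_q_gt_1 by (simp add: measure_def emeasure_ppow emeasure_coset)

lemma set_integrable_shell:
  fixes g :: "'a \<Rightarrow> complex"
  assumes g: "\<And>x y. x \<in> shell n \<Longrightarrow> y \<in> ppow j \<Longrightarrow> g (x + y) = g x"
    and B: "\<And>x. x \<in> shell n \<Longrightarrow> norm (g x) \<le> B"
  shows "set_integrable \<mu> (shell n) g"
  unfolding set_integrable_def
proof (rule Bochner_Integration.integrable_bound)
  show "integrable \<mu> (\<lambda>x. \<bar>B\<bar> * indicator (ppow n) x)"
    by (intro integrable_mult_right integrable_real_indicator open_in_sets_haar open_ppow)
      (simp add: emeasure_ppow)
  show "(\<lambda>x. indicator (shell n) x *\<^sub>R g x) \<in> borel_measurable \<mu>"
    unfolding borel_measurable_haar by (rule borel_measurable_on_shell[OF g])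
  show "AE x in \<mu>. norm (indicator (shell n) x *\<^sub>R g x) \<le> norm (\<bar>B\<bar> * indicator (ppow n) x)"
    using B shell_subset_ppow by (intro AE_I2) (force split: split_indicator)
qed

text \<open>
  Vanishing of shell integrals is tested by averaging the integrand over finitely many
  translations; this avoids any multiplicative change of variables.
\<close>

lemma shell_integral_eq_0_by_averaging:
  fixes g :: "'a \<Rightarrow> complex"
  assumes g: "\<And>x y. x \<in> shell n \<Longrightarrow> y \<in> ppow j \<Longrightarrow> g (x + y) = g x"
    and B: "\<And>x. x \<in> shell n \<Longrightarrow> norm (g x) \<le> B"
    and c: "c \<in> ppow (n + 1)"
    and avg: "\<And>x. x \<in> shell n \<Longrightarrow> (\<Sum>y\<in>residue_reps. g (x + c * y)) = 0"
  shows "(LINT x:shell n|\<mu>. g x) = 0"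
proof -
  define h where "h = (\<lambda>x. indicator (shell n) x *\<^sub>R g x)"
  have meas: "h \<in> borel_measurable borel"
    unfolding h_def by (rule borel_measurable_on_shell[OF g])
  have int: "integrable \<mu> h"
    using set_integrable_shell[OF g B] by (simp add: set_integrable_def h_def)
  \<comment> \<open>Because \<open>c * y\<close> lies in p^(n+1), translation by it preserves the
    shell and its complement, so the averaging hypothesis extends by zero to the whole
    field.\<close>
  have "(\<Sum>y\<in>residue_reps. h (c * y + x)) = 0" for x
  proof -
    have "indicator (shell n) (c * y + x) = (indicator (shell n) x :: real)"
      if "y \<in> residue_reps" for y
      using shell_add_iff[of "c * y" n x] ppow_mult[OF c residue_reps_val_ring[OF that]]
      by (simp add: indicator_def add.commute)
    then have "(\<Sum>y\<in>residue_reps. h (c * y + x)) =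
        indicator (shell n) x *\<^sub>R (\<Sum>y\<in>residue_reps. g (x + c * y))"
      by (simp add: h_def scaleR_sum_right add.commute)
    then show ?thesis
      using avg[of x] by (simp split: split_indicator)
  qed
  then have "0 = (\<integral>x. (\<Sum>y\<in>residue_reps. h (c * y + x)) \<partial>\<mu>)"
    by simp
  also have "\<dots> = (\<Sum>y\<in>residue_reps. \<integral>x. h (c * y + x) \<partial>\<mu>)"
    by (rule Bochner_Integration.integral_sum) (rule integrable_translate[OF meas int])
  also have "\<dots> = of_nat (residue_card TYPE('a)) * (\<integral>x. h x \<partial>\<mu>)"
    by (simp add: integral_translate[OF meas] card_residue_reps)
  finally show ?thesis
    using residue_card_ge_2[where ?'a = 'a]
    by (auto simp: set_lebesgue_integral_def h_def)
qed

text \<open>The shell is the disjoint union of the cosets of p^(n+1) around \<open>c * y\<close> for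
  the non-zero classes \<open>y\<close>, and \<open>g\<close> is constant on each of them.\<close>

lemma shell_integral_eq_sum:
  fixes g :: "'a \<Rightarrow> complex"
  assumes c: "c \<in> shell n" and g: "\<And>x y. x \<in> shell n \<Longrightarrow> y \<in> ppow (n + 1) \<Longrightarrow> g (x + y) = g x"
  shows "(LINT x:shell n|\<mu>. g x) =
    of_real (residue_q TYPE('a) powi (- (n + 1))) * (\<Sum>y\<in>residue_reps - max_ideal. g (c * y))"
proof -
  define K where "K = (\<lambda>y. {x. x - c * y \<in> ppow (n + 1)})"
  have K: "K y \<in> sets \<mu>" "emeasure \<mu> (K y) < \<infinity>" "measure \<mu> (K y) = residue_q TYPE('a) powi (- (n + 1))" for y
    by (auto simp: K_def open_in_sets_haar open_ppow_coset emeasure_coset emeasure_ppow measure_coset)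
  have cy: "c * y \<in> shell n" if "y \<in> residue_reps - max_ideal" for y
    using shell_mult[OF c, of y 0] that by (auto simp: residue_reps_val_ring shell_eq[of 0])
  have pt: "indicator (shell n) x *\<^sub>R g x = (\<Sum>y\<in>residue_reps - max_ideal. indicator (K y) x *\<^sub>R g (c * y))" for x
  proof (cases "x \<in> ppow n")
    case False
    have "x \<notin> K y" if "y \<in> residue_reps" for y
      using False that ppow_eq_Union_cosets(1)[OF c] by (auto simp: K_def)
    then show ?thesis
      using False by (simp add: shell_eq)
  next
    case True
    then obtain y where y: "y \<in> residue_reps" "x \<in> K y"
      using ppow_eq_Union_cosets(1)[OF c] by (auto simp: K_def)
    have other: "x \<notin> K z" if "z \<in> residue_reps" "z \<noteq> y" for z
      using disjoint_family_onD[OF ppow_eq_Union_cosets(2)[OF c] that(1) y(1) that(2)] y(2)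
      by (auto simp: K_def)
    have xcy: "x - c * y \<in> ppow (n + 1)" using y(2) by (simp add: K_def)
    show ?thesis
    proof (cases "y \<in> max_ideal")
      case True
      then have "c * y \<in> ppow (n + 1)"
        using ppow_mult[OF shell_subset_ppow[OF c]] by simp
      then have "x \<notin> shell n"
        using ppow_add[OF xcy, of "c * y"] by (simp add: shell_eq)
      moreover have "x \<notin> K z" if "z \<in> residue_reps - max_ideal" for z
        using other[of z] that True by auto
      ultimately show ?thesis by simp
    next
      case False
      then have y': "y \<in> residue_reps - max_ideal" using y by simp
      have "x \<in> shell n" "g x = g (c * y)"
        using shell_add[OF cy[OF y'] xcy] g[OF cy[OF y'] xcy] by simp_all
      moreover have "(\<Sum>z\<in>residue_reps - max_ideal. indicator (K z) x *\<^sub>R g (c * z)) =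
          (\<Sum>z\<in>residue_reps - max_ideal. if z = y then g (c * y) else 0)"
        using other y(2) by (intro sum.cong refl) auto
      ultimately show ?thesis
        using y' by simp
    qed
  qed
  have "(LINT x:shell n|\<mu>. g x) =
      (\<integral>x. (\<Sum>y\<in>residue_reps - max_ideal. indicator (K y) x *\<^sub>R g (c * y)) \<partial>\<mu>)"
    unfolding set_lebesgue_integral_def pt ..
  also have "\<dots> = (\<Sum>y\<in>residue_reps - max_ideal. \<integral>x. indicator (K y) x *\<^sub>R g (c * y) \<partial>\<mu>)"
    by (rule Bochner_Integration.integral_sum)
      (intro integrable_scaleR_left integrable_real_indicator K)
  also have "\<dots> = (\<Sum>y\<in>residue_reps - max_ideal. of_real (residue_q TYPE('a) powi (- (n + 1))) * g (c * y))"
    using K by (intro sum.cong refl) (simp add: scaleR_conv_of_real)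
  finally show ?thesis
    by (simp add: sum_distrib_left)
qed

lemma integral_shell_1: "(LINT x:shell n|\<mu>. (1 :: complex)) =
    of_real (residue_q TYPE('a) powi (- n) - residue_q TYPE('a) powi (- (n + 1)))"
proof -
  have "shell n \<in> sets \<mu>"
    by (intro open_in_sets_haar open_shell)
  then have "(LINT x:shell n|\<mu>. (1 :: complex)) = of_real (measure \<mu> (shell n))"
    by (simp add: set_lebesgue_integral_def scaleR_conv_of_real space_haar)
  also have "measure \<mu> (shell n) = measure \<mu> (ppow n) - measure \<mu> (ppow (n + 1))"
    unfolding shell_eq
    by (rule measure_Diff) (auto simp: emeasure_ppow open_in_sets_haar open_ppow elim: ppow_mono)
  finally show ?thesis by (simp add: measure_ppow)
qed

text \<open>The density |x|^(-1) is constant on a shell, so all multiplicative integrals reduce to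
  additive ones.\<close>

lemma mult_haar_shell_integral:
  fixes g :: "'a \<Rightarrow> complex"
  assumes g: "\<And>x y. x \<in> shell n \<Longrightarrow> y \<in> ppow j \<Longrightarrow> g (x + y) = g x"
  shows "(LINT x:shell n|mult_haar \<mu>. g x) = of_real (residue_q TYPE('a) powi n) * (LINT x:shell n|\<mu>. g x)"
proof -
  have "(LINT x:shell n|mult_haar \<mu>. g x) =
      (\<integral>x. inverse (absv x) *\<^sub>R (indicator (shell n) x *\<^sub>R g x) \<partial>\<mu>)"
    unfolding mult_haar_def set_lebesgue_integral_def
  proof (rule integral_density)
    show "(\<lambda>x. indicator (shell n) x *\<^sub>R g x) \<in> borel_measurable \<mu>"
      unfolding borel_measurable_haar by (rule borel_measurable_on_shell[OF g])
    show "(\<lambda>x. inverse (absv x)) \<in> borel_measurable \<mu>"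
      unfolding borel_measurable_haar by (intro borel_measurable_inverse borel_measurable_absv)
    show "AE x in \<mu>. 0 \<le> inverse (absv x)"
      using residue_q_gt_1 by (intro AE_I2) (simp add: absv_def)
  qed
  also have "\<dots> = (\<integral>x. (residue_q TYPE('a) powi n) *\<^sub>R (indicator (shell n) x *\<^sub>R g x) \<partial>\<mu>)"
    by (intro Bochner_Integration.integral_cong refl)
      (auto simp: absv_shell power_int_minus split: split_indicator)
  finally show ?thesis
    by (simp add: set_lebesgue_integral_def scaleR_conv_of_real)
qed

end

section \<open>Gauss sums and quadratic Gauss integrals\<close>

lemma ppow_square_diff:
  assumes "x \<in> ppow n" "y \<in> ppow n" "x - y \<in> ppow m" "a \<in> ppow k" "l \<le> k + m + n"
  shows "a * x\<^sup>2 - a * y\<^sup>2 \<in> ppow l"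
proof -
  have "a * x\<^sup>2 - a * y\<^sup>2 = a * ((x - y) * (x + y))"
    by (simp add: power2_eq_square algebra_simps)
  moreover have "a * ((x - y) * (x + y)) \<in> ppow (k + (m + n))"
    by (intro ppow_mult ppow_add assms)
  ultimately show ?thesis
    using assms(5) ppow_mono[of _ "k + (m + n)" l] by simp
qed

text \<open>The terms are the volumes of the shells inside p^m, telescoping to the volume of p^m.
  Non-negativity upgrades the convergent series to an unconditional sum.\<close>

lemma has_sum_geometric_shells:
  fixes q :: real
  assumes q: "1 < q"
  shows "((\<lambda>l. if m \<le> l then of_real (q powi (- l) - q powi (- (l + 1))) else 0 :: complex)
    has_sum of_real (q powi (- m))) UNIV"
proof -
  define f where "f = (\<lambda>k. q powi (- m) * (1 / q) ^ k)"
  have f: "f k = q powi (- (m + int k))" for k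
    using q by (simp add: f_def power_int_add power_int_minus power_int_diff field_simps)
  have "f \<longlonglongrightarrow> q powi (- m) * 0"
    unfolding f_def using q by (intro tendsto_mult tendsto_const LIMSEQ_realpow_zero) auto
  then have "(\<lambda>k. f k - f (Suc k)) sums (q powi (- m))"
    using telescope_sums'[of f 0] by (simp add: f_def)
  moreover have "0 \<le> f k - f (Suc k)" for k
    using q unfolding f_def by (simp add: field_simps)
  ultimately have "((\<lambda>k. f k - f (Suc k)) has_sum (q powi (- m))) UNIV"
    by (rule sums_nonneg_imp_has_sum)
  then have "((\<lambda>k. of_real (f k - f (Suc k)) :: complex) has_sum of_real (q powi (- m))) UNIV"
    using has_sum_bounded_linear[OF bounded_linear_of_real] by blast
  moreover have "(\<lambda>k. of_real (f k - f (Suc k)) :: complex) =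
      (\<lambda>l. of_real (q powi (- l) - q powi (- (l + 1)))) \<circ> (\<lambda>k. m + int k)"
    unfolding f by (auto simp: add_ac)
  ultimately have "((\<lambda>l. of_real (q powi (- l) - q powi (- (l + 1))) :: complex)
      has_sum of_real (q powi (- m))) ((\<lambda>k. m + int k) ` UNIV)"
    by (subst has_sum_reindex) (auto simp: inj_on_def)
  also have "(\<lambda>k. m + int k) ` UNIV = {m..}"
    using zle_iff_zadd by auto
  finally show ?thesis
    by (rule has_sum_cong_neutral[THEN iffD1, rotated -1]) auto
qed

section \<open>Quadratic Gauss sums over the residue field\<close>

context
  fixes \<Psi> :: "'a::nonarch_local_field \<Rightarrow> complex" and r :: int
  assumes char: "residual_char_not_2 TYPE('a)"
    and nontriv: "nontrivial_additive_character \<Psi>" and r: "r = depth \<Psi>"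
begin

lemma character_additive: "additive_character \<Psi>"
  using nontriv by (simp add: nontrivial_additive_character_def)

lemma character_trivial: "x \<in> ppow (r + 1) \<Longrightarrow> \<Psi> x = 1"
  using trivial_above_depth[OF nontriv] by (simp add: r)

lemma char_perturb: "x - y \<in> ppow (r + 1) \<Longrightarrow> \<Psi> x = \<Psi> y"
  by (rule additive_character_perturb[OF character_additive]) (rule character_trivial)

lemma char_square_perturb:
  assumes "x \<in> ppow n" "y \<in> ppow n" "x - y \<in> ppow m" "a \<in> ppow k" "r + 1 \<le> k + m + n"
  shows "\<Psi> (a * x\<^sup>2) = \<Psi> (a * y\<^sup>2)"
  by (rule char_perturb[OF ppow_square_diff[OF assms]])

definition quadratic_sum :: "'a \<Rightarrow> complex" where
  "quadratic_sum d = (\<Sum>x\<in>residue_reps. \<Psi> (d * x\<^sup>2))"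

lemma gauss_sum_eq:
  "quadratic_sum ((- w) powi r) = of_real (residue_q TYPE('a) powr (1 / 2)) * gauss_sum w \<Psi>"
proof -
  have "quadratic_sum ((- w) powi r) =
      (\<Sum>C\<in>residue_classes. \<Psi> ((- w) powi r * (SOME X. X \<in> C)\<^sup>2))"
    unfolding quadratic_sum_def residue_reps_def
    by (subst sum.reindex[OF inj_residue_some]) simp
  moreover have "residue_q TYPE('a) powr (1 / 2) * residue_q TYPE('a) powr (- 1 / 2) = 1"
    using residue_card_ge_2[where ?'a = 'a] by (simp flip: powr_add)
  then have "complex_of_real (residue_q TYPE('a) powr (1 / 2)) *
      of_real (residue_q TYPE('a) powr (- 1 / 2)) = 1"
    by (metis of_real_1 of_real_mult)
  ultimately show ?thesis
    by (simp add: gauss_sum_def r mult.assoc[symmetric])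
qed

text \<open>For e = y^2 the substitution x -> y x permutes the classes. For a non-square
  \<open>e\<close> the sums for \<open>d\<close> and \<open>d * e\<close> add up to twice a full
  character sum, which vanishes because \<open>d\<close> has valuation exactly the depth.\<close>

lemma quadratic_sum_unit:
  assumes d: "d \<in> shell r" and e: "e \<in> shell 0"
  shows "quadratic_sum (d * e) = square_char e * quadratic_sum d"
proof (cases "is_square e")
  case True
  then obtain y where y: "e = y\<^sup>2" by (auto simp: is_square_def)
  then have yu: "y \<in> shell 0"
    using e by (cases "y = 0") (auto simp: shell_def vord_power)
  have "quadratic_sum (d * e) = (\<Sum>x\<in>residue_reps. \<Psi> (d * (y * x)\<^sup>2))"
    by (simp add: quadratic_sum_def y power_mult_distrib mult.assoc)
  also have "\<dots> = quadratic_sum d"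
    unfolding quadratic_sum_def
  proof (rule sum_residue_reps_reindex)
    show "y * x \<in> val_ring" if "x \<in> val_ring" for x
      using ppow_mult[OF shell_subset_ppow[OF yu] that] by simp
    show "x - z \<in> max_ideal" if "y * x - y * z \<in> max_ideal" for x z
      using that ppow_shell_cancel[OF yu, of "x - z" 1] by (simp add: right_diff_distrib)
    show "\<Psi> (d * x\<^sup>2) = \<Psi> (d * z\<^sup>2)" if "x \<in> val_ring" "z \<in> val_ring" "x - z \<in> max_ideal" for x z
      by (rule char_square_perturb[OF that shell_subset_ppow[OF d]]) simp
  qed
  finally show ?thesis using True by (simp add: square_char_def)
next
  case False
  then have le: "lifts_nonsquare e"
    using lifts_nonsquare_iff[OF char e] by simp
  have "(\<Sum>x\<in>residue_reps. \<Psi> (d * x\<^sup>2)) + (\<Sum>x\<in>residue_reps. \<Psi> (d * (e * x\<^sup>2))) =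
      2 * (\<Sum>x\<in>residue_reps. \<Psi> (d * x))"
  proof (rule sum_over_squares[OF char le])
    fix x y :: 'a assume "x - y \<in> max_ideal"
    then have "d * x - d * y \<in> ppow (r + 1)"
      using ppow_mult[OF shell_subset_ppow[OF d]] by (simp add: right_diff_distrib[symmetric])
    then show "\<Psi> (d * x) = \<Psi> (d * y)"
      by (rule char_perturb)
  qed
  also have "(\<Sum>x\<in>residue_reps. \<Psi> (d * x)) = 0"
    using nontrivial_at_depth[OF nontriv]
    by (intro sum_character_scaled_reps[OF character_additive character_trivial _ d]) (simp_all add: r)
  finally show ?thesis
    using False by (simp add: quadratic_sum_def square_char_def mult.assoc add_eq_0_iff)
qed

text \<open>The base point (-w)^r of \<open>gauss_sum\<close> is a power of -w, the norm of sqrt w,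
  so sgn_w equals 1 there. Any other \<open>d\<close> of valuation r differs from it by a unit, on
  which sgn_w is the residue symbol.\<close>

lemma quadratic_sum_eq:
  assumes w: "uniformiser w" and d: "d \<in> shell r"
  shows "quadratic_sum d = of_real (residue_q TYPE('a) powr (1 / 2)) * (sgn_char w d * gauss_sum w \<Psi>)"
proof -
  have w0: "w \<noteq> 0" "vord w = 1" using w by (auto simp: uniformiser_def)
  define p where "p = (- w) powi r"
  have p: "p \<in> shell r" "p \<noteq> 0" "vord p = r"
    using w0 by (auto simp: p_def shell_def vord_powi)
  have even_powi: "is_square ((- w) powi k)" if k: "even k" for k
  proof -
    obtain j where "k = 2 * j"
      using k by (rule evenE)
    then have "(- w) powi k = ((- w) powi j)\<^sup>2"
      using power_int_mult[of "- w" j 2] by (simp add: mult.commute)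
    then show ?thesis by (simp only: is_square_power2)
  qed
  have "sgn_char w p = 1"
  proof (cases "even r")
    case True
    then show ?thesis
      using sgn_char_uniformiser[OF char w p(2)] even_powi[of r] by (simp add: p square_char_def p_def[symmetric])
  next
    case False
    have "- w * p = (- w) powi (r + 1)"
      using w0 by (simp add: p_def power_int_add)
    then have "is_square (- w * p)"
      using even_powi[of "r + 1"] False by simp
    then show ?thesis
      using sgn_char_uniformiser[OF char w p(2)] False by (simp add: p square_char_def)
  qed
  moreover have e: "d / p \<in> shell 0"
    using shell_mult[OF d shell_inverse[OF p(1)]] by (simp add: divide_inverse)
  then have "sgn_char w (d / p) = square_char (d / p)"
    using sgn_char_uniformiser[OF char w shell_nonzero[OF e]] by (simp add: vord_shell)
  moreover have dp: "d = p * (d / p)" using p by simp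
  then have "sgn_char w d = sgn_char w p * sgn_char w (d / p)"
    using sgn_char_uniformiser_mult[OF char w p(2) shell_nonzero[OF e]] by simp
  moreover have "quadratic_sum d = square_char (d / p) * quadratic_sum p"
    using quadratic_sum_unit[OF p(1) e] dp by simp
  ultimately show ?thesis
    using gauss_sum_eq[of w] by (simp add: p_def[symmetric])
qed

section \<open>The quadratic Gauss integral, shell by shell\<close>

context
  fixes \<mu> :: "'a measure" and w a :: 'a and A :: int
  assumes haar: "normalised_haar \<mu>" and w: "uniformiser w" and a: "a \<in> shell A"
begin

text \<open>The translation size r - A - l is chosen so that the cross term 2axcy has coefficient of
  valuation exactly r and runs through a non-trivial character of the residue field. The term
  a(cy)^2 then has valuation at least 2r - A - 2l > r and is invisible.\<close>

lemma shell_char_square_below_depth: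
  assumes l: "A + 2 * l < r"
  shows "(LINT t:shell l|\<mu>. \<Psi> (a * t\<^sup>2)) = 0"
proof -
  obtain c :: 'a where c: "c \<in> shell (r - A - l)"
    by (rule shell_nonempty)
  show ?thesis
  proof (rule shell_integral_eq_0_by_averaging[OF haar, where B = 1 and c = c and j = "max l (r + 1 - A - l)"])
    fix x y :: 'a assume x: "x \<in> shell l" and y: "y \<in> ppow (max l (r + 1 - A - l))"
    have y1: "y \<in> ppow l" "y \<in> ppow (r + 1 - A - l)"
      using y by (auto elim: ppow_mono)
    show "\<Psi> (a * (x + y)\<^sup>2) = \<Psi> (a * x\<^sup>2)"
      by (rule char_square_perturb[OF ppow_add[OF shell_subset_ppow[OF x] y1(1)]
            shell_subset_ppow[OF x] _ shell_subset_ppow[OF a], of "r + 1 - A - l"])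
        (use y1 in auto)
  next
    show "norm (\<Psi> (a * x\<^sup>2)) \<le> 1" for x
      by (simp add: norm_additive_character[OF character_additive])
    show "c \<in> ppow (l + 1)"
      using shell_subset_ppow[OF c] by (rule ppow_mono) (use l in simp)
  next
    fix x :: 'a assume x: "x \<in> shell l"
    define b where "b = 2 * a * x * c"
    have "b \<in> shell (0 + A + l + (r - A - l))"
      unfolding b_def by (intro shell_mult two_in_shell[OF char] a x c)
    then have b: "b \<in> shell r" by simp
    have "\<Psi> (a * (x + c * y)\<^sup>2) = \<Psi> (a * x\<^sup>2) * \<Psi> (b * y)" if "y \<in> residue_reps" for y
    proof -
      have y: "y \<in> val_ring" by (rule residue_reps_val_ring[OF that])
      have cy: "c * y \<in> ppow (r - A - l)"
        using ppow_mult[OF shell_subset_ppow[OF c] y] by simp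
      have "a * ((c * y) * (c * y)) \<in> ppow (r + 1)"
        using shell_subset_ppow[OF a] ppow_mult[OF cy cy]
        by (rule ppow_mult_le) (use l in simp)
      then have "\<Psi> (a * ((c * y) * (c * y))) = 1"
        by (rule character_trivial)
      moreover have "a * (x + c * y)\<^sup>2 = a * x\<^sup>2 + b * y + a * ((c * y) * (c * y))"
        by (simp add: b_def power2_eq_square algebra_simps)
      ultimately show ?thesis
        by (simp add: additive_character_add[OF character_additive])
    qed
    then have "(\<Sum>y\<in>residue_reps. \<Psi> (a * (x + c * y)\<^sup>2)) =
        \<Psi> (a * x\<^sup>2) * (\<Sum>y\<in>residue_reps. \<Psi> (b * y))"
      by (simp add: sum_distrib_left)
    also have "(\<Sum>y\<in>residue_reps. \<Psi> (b * y)) = 0"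
      using nontrivial_at_depth[OF nontriv]
      by (intro sum_character_scaled_reps[OF character_additive character_trivial _ b]) (simp_all add: r)
    finally show "(\<Sum>y\<in>residue_reps. \<Psi> (a * (x + c * y)\<^sup>2)) = 0" by simp
  qed
qed

lemma shell_char_square_above_depth:
  assumes l: "r < A + 2 * l"
  shows "(LINT t:shell l|\<mu>. \<Psi> (a * t\<^sup>2)) =
    of_real (residue_q TYPE('a) powi (- l) - residue_q TYPE('a) powi (- (l + 1)))"
proof -
  have "\<Psi> (a * t\<^sup>2) = 1" if "t \<in> shell l" for t
  proof (rule character_trivial)
    have "a * (t * t) \<in> ppow (A + (l + l))"
      by (intro ppow_mult shell_subset_ppow a that)
    then show "a * t\<^sup>2 \<in> ppow (r + 1)"
      using l by (auto simp: power2_eq_square elim: ppow_mono)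
  qed
  then have "(LINT t:shell l|\<mu>. \<Psi> (a * t\<^sup>2)) = (LINT t:shell l|\<mu>. 1)"
    by (intro set_lebesgue_integral_cong open_in_sets_haar[OF haar] open_shell) simp
  then show ?thesis by (simp add: integral_shell_1[OF haar])
qed

text \<open>The shell contains only the non-zero classes, so the zero class, with value 1, has to be
  subtracted from the full quadratic sum. The factor in front is the volume of a coset of
  p^(l+1).\<close>

lemma shell_char_square_at_depth:
  assumes l: "A + 2 * l = r"
  shows "(LINT t:shell l|\<mu>. \<Psi> (a * t\<^sup>2)) = of_real (residue_q TYPE('a) powi (- (l + 1))) *
    (of_real (residue_q TYPE('a) powr (1 / 2)) * (sgn_char w a * gauss_sum w \<Psi>) - 1)"
proof -
  obtain c :: 'a where c: "c \<in> shell l" by (rule shell_nonempty)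
  define d where "d = a * c\<^sup>2"
  have "a * (c * c) \<in> shell (A + (l + l))"
    by (intro shell_mult a c)
  then have d: "d \<in> shell r"
    using l by (simp add: d_def power2_eq_square algebra_simps)
  have "(LINT t:shell l|\<mu>. \<Psi> (a * t\<^sup>2)) = of_real (residue_q TYPE('a) powi (- (l + 1))) *
      (\<Sum>y\<in>residue_reps - max_ideal. \<Psi> (a * (c * y)\<^sup>2))"
  proof (rule shell_integral_eq_sum[OF haar c])
    fix x y :: 'a assume x: "x \<in> shell l" and y: "y \<in> ppow (l + 1)"
    show "\<Psi> (a * (x + y)\<^sup>2) = \<Psi> (a * x\<^sup>2)"
      by (rule char_square_perturb[OF shell_subset_ppow[OF shell_add[OF x y]]
            shell_subset_ppow[OF x] _ shell_subset_ppow[OF a], of "l + 1"])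
        (use y l in auto)
  qed
  also have "(\<Sum>y\<in>residue_reps - max_ideal. \<Psi> (a * (c * y)\<^sup>2)) =
      (\<Sum>y\<in>residue_reps - max_ideal. \<Psi> (d * y\<^sup>2))"
    by (simp add: d_def power_mult_distrib mult.assoc)
  also have "\<dots> = quadratic_sum d - 1"
  proof -
    have rep0: "residue_rep 0 \<in> residue_reps \<inter> (max_ideal :: 'a set)"
      using residue_rep[of "0 :: 'a"] by simp
    have int: "residue_reps \<inter> max_ideal = {residue_rep 0 :: 'a}"
    proof (intro equalityI subsetI)
      fix x :: 'a assume "x \<in> residue_reps \<inter> max_ideal"
      then show "x \<in> {residue_rep 0}"
        using rep0 ppow_diff[of x 1 "residue_rep 0"] residue_reps_unique[of x "residue_rep 0"] by simp
    qed (use rep0 in auto)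
    have "\<Psi> (d * (residue_rep 0)\<^sup>2) = \<Psi> (d * 0\<^sup>2)"
      by (rule char_square_perturb[of _ 0 _ 1, OF _ _ _ shell_subset_ppow[OF d]])
        (use rep0 residue_reps_val_ring[of "residue_rep 0"] in auto)
    then have "(\<Sum>y\<in>residue_reps \<inter> max_ideal. \<Psi> (d * y\<^sup>2)) = 1"
      by (simp add: int additive_character_0[OF character_additive])
    then show ?thesis
      using sum.Int_Diff[OF finite_residue_reps, of "\<lambda>y. \<Psi> (d * y\<^sup>2)" max_ideal]
      by (simp add: quadratic_sum_def)
  qed
  also have "sgn_char w d = sgn_char w a"
    unfolding d_def by (rule sgn_char_mult_power2) (rule shell_nonzero[OF c])
  then have "quadratic_sum d =
      of_real (residue_q TYPE('a) powr (1 / 2)) * (sgn_char w a * gauss_sum w \<Psi>)"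
    using quadratic_sum_eq[OF w d] by simp
  finally show ?thesis .
qed

text \<open>For odd r - A the contributing shells fill p^m with 2m = r + 1 - A. For even r - A the
  shell at the depth adds a quadratic sum minus 1, and this -1 cancels the entire tail p^(m+1); only
  the Gauss sum survives, its factor q^(1/2) bringing the exponent to the same form.\<close>

lemma quadratic_gauss_integral:
  "(\<Sum>\<^sub>\<infinity>l\<in>UNIV. LINT t:shell l|\<mu>. \<Psi> (a * t\<^sup>2)) =
    of_real (residue_q TYPE('a) powr (- (of_int r + 1 - of_int A) / 2)) *
      (if even (r - A) then sgn_char w a * gauss_sum w \<Psi> else 1)"
proof (rule infsumI, cases "even (r - A)")
  let ?q = "residue_q TYPE('a)"
  have q: "1 < ?q" by (rule residue_q_gt_1)
  let ?F = "\<lambda>l. LINT t:shell l|\<mu>. \<Psi> (a * t\<^sup>2)"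
  let ?T = "\<lambda>m l. if m \<le> l then of_real (?q powi (- l) - ?q powi (- (l + 1))) else 0 :: complex"
  {
    case False
    define m where "m = (r - A + 1) div 2"
    have m: "2 * m = r + 1 - A" using False by (simp add: m_def) presburger
    have "?F l = ?T m l" for l
      using shell_char_square_below_depth[of l] shell_char_square_above_depth[of l] m by auto
    then have "(?F has_sum of_real (?q powi (- m))) UNIV"
      using has_sum_geometric_shells[OF q, of m] by presburger
    moreover have "?q powi (- m) = ?q powr (- (of_int r + 1 - of_int A) / 2)"
    proof -
      have "- (of_int r + 1 - of_int A) / 2 = (of_int (- m) :: real)"
        using arg_cong[OF m, of real_of_int] by simp
      then show ?thesis using q powr_real_of_int'[of ?q "- m"] by simp
    qed
    ultimately show "(?F has_sum of_real (?q powr (- (of_int r + 1 - of_int A) / 2)) *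
      (if even (r - A) then sgn_char w a * gauss_sum w \<Psi> else 1)) UNIV"
      using False by simp
  next
    case True
    define m where "m = (r - A) div 2"
    have m: "2 * m = r - A" using True by (simp add: m_def)
    let ?S = "of_real (?q powr (1 / 2)) * (sgn_char w a * gauss_sum w \<Psi>)"
    \<comment> \<open>The correction term at the single boundary shell; the tail
      \<open>?T (m + 1)\<close> accounts for everything beyond it.\<close>
    let ?E = "\<lambda>l. if l = m then of_real (?q powi (- (m + 1))) * (?S - 1) else 0"
    have "?F l = ?T (m + 1) l + ?E l" for l
      using shell_char_square_below_depth[of l] shell_char_square_above_depth[of l]
        shell_char_square_at_depth[of l] m by auto
    moreover have "(?E has_sum of_real (?q powi (- (m + 1))) * (?S - 1)) UNIV"
      by (rule has_sum_cong_neutral[THEN iffD1, rotated -1, OF has_sum_finite[of "{m}"], simplified]) auto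
    ultimately have "(?F has_sum (of_real (?q powi (- (m + 1))) +
        of_real (?q powi (- (m + 1))) * (?S - 1))) UNIV"
      using has_sum_add[OF has_sum_geometric_shells[OF q, of "m + 1"]] by presburger
    moreover have "of_real (?q powi (- (m + 1))) + of_real (?q powi (- (m + 1))) * (?S - 1) =
        of_real (?q powi (- (m + 1)) * ?q powr (1 / 2)) * (sgn_char w a * gauss_sum w \<Psi>)"
      by (simp add: algebra_simps)
    moreover have "?q powi (- (m + 1)) * ?q powr (1 / 2) =
        ?q powr (- (of_int r + 1 - of_int A) / 2)"
    proof -
      have eq: "- (of_int r + 1 - of_int A) / 2 = (of_int (- (m + 1)) + 1 / 2 :: real)"
        using arg_cong[OF m, of real_of_int] by (simp add: field_simps)
      show ?thesis
        unfolding eq powr_add using q powr_real_of_int'[of ?q "- (m + 1)"] by simp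
    qed
    ultimately show "(?F has_sum of_real (?q powr (- (of_int r + 1 - of_int A) / 2)) *
      (if even (r - A) then sgn_char w a * gauss_sum w \<Psi> else 1)) UNIV"
      using True by (simp only: if_True)
  }
qed

end

end

section \<open>Bessel functions of tame characters\<close>

text \<open>Invariance under multiplication by 1 + p, written additively on each shell, together
  with a bound per shell for integrability. Unlike the notion of a character it is closed under
  sums, so it covers the indicator of a norm group and the expanded projectors.\<close>

definition tame :: "('a::nonarch_local_field \<Rightarrow> complex) \<Rightarrow> bool" where
  "tame \<kappa> \<longleftrightarrow> (\<forall>n. \<forall>x\<in>shell n. \<forall>y\<in>ppow (n + 1). \<kappa> (x + y) = \<kappa> x) \<and>
     (\<forall>n. \<exists>B. \<forall>x\<in>shell n. norm (\<kappa> x) \<le> B)"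

lemma tame_perturb: "tame \<kappa> \<Longrightarrow> x \<in> shell n \<Longrightarrow> y \<in> ppow (n + 1) \<Longrightarrow> \<kappa> (x + y) = \<kappa> x"
  by (simp add: tame_def)

lemma tame_bound:
  assumes "tame \<kappa>"
  obtains B where "\<And>x. x \<in> shell n \<Longrightarrow> norm (\<kappa> x) \<le> B"
proof -
  have "\<exists>B. \<forall>x\<in>shell n. norm (\<kappa> x) \<le> B"
    using assms by (simp add: tame_def)
  then show thesis using that by blast
qed

lemma tame_const: "tame (\<lambda>x. c)"
  by (auto simp: tame_def)

lemma tame_add:
  assumes "tame \<kappa>" "tame \<eta>"
  shows "tame (\<lambda>x. \<kappa> x + \<eta> x)"
proof -
  have "\<exists>B. \<forall>x\<in>shell n. norm (\<kappa> x + \<eta> x) \<le> B" for n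
  proof -
    obtain B C where "\<And>x. x \<in> shell n \<Longrightarrow> norm (\<kappa> x) \<le> B" "\<And>x. x \<in> shell n \<Longrightarrow> norm (\<eta> x) \<le> C"
      using tame_bound[OF assms(1)] tame_bound[OF assms(2)] by metis
    then show ?thesis
      by (intro exI[of _ "B + C"] ballI norm_triangle_le add_mono)
  qed
  then show ?thesis
    using assms unfolding tame_def by simp
qed

lemma tame_mult:
  assumes "tame \<kappa>" "tame \<eta>"
  shows "tame (\<lambda>x. \<kappa> x * \<eta> x)"
proof -
  have "\<exists>B. \<forall>x\<in>shell n. norm (\<kappa> x * \<eta> x) \<le> B" for n
  proof -
    obtain B C where BC: "\<And>x. x \<in> shell n \<Longrightarrow> norm (\<kappa> x) \<le> B" "\<And>x. x \<in> shell n \<Longrightarrow> norm (\<eta> x) \<le> C"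
      using tame_bound[OF assms(1)] tame_bound[OF assms(2)] by metis
    have "norm (\<kappa> x * \<eta> x) \<le> B * C" if "x \<in> shell n" for x
      unfolding norm_mult using BC[OF that] order_trans[OF norm_ge_zero BC(1)[OF that]]
      by (intro mult_mono) auto
    then show ?thesis by blast
  qed
  then show ?thesis
    using assms unfolding tame_def by simp
qed

lemma tame_nu: "tame (nu \<alpha>)"
  unfolding tame_def
proof (intro conjI allI)
  show "\<forall>x\<in>shell n. \<forall>y\<in>ppow (n + 1). nu \<alpha> (x + y) = nu \<alpha> (x :: 'a)" for n
  proof (intro ballI)
    fix x y :: 'a assume "x \<in> shell n" "y \<in> ppow (n + 1)"
    then have "x \<in> shell n" "x + y \<in> shell n" by (auto intro: shell_add)
    then show "nu \<alpha> (x + y) = nu \<alpha> x"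
      by (simp add: nu_def absv_def shell_def)
  qed
  show "\<exists>B. \<forall>x::'a\<in>shell n. norm (nu \<alpha> x) \<le> B" for n
    by (rule exI[of _ "(residue_q TYPE('a) powi (- n)) powr \<alpha>"])
      (simp add: nu_def absv_def shell_def)
qed

lemma tame_sgn_char:
  assumes "residual_char_not_2 TYPE('a::nonarch_local_field)"
  shows "tame (sgn_char (\<theta> :: 'a))"
  unfolding tame_def
proof (intro conjI allI)
  show "\<forall>x\<in>shell n. \<forall>y\<in>ppow (n + 1). sgn_char \<theta> (x + y) = sgn_char \<theta> x" for n
    using sgn_char_perturb[OF assms] by blast
  show "\<exists>B. \<forall>x\<in>shell n. norm (sgn_char \<theta> x) \<le> B" for n
    by (rule exI[of _ 1]) (simp add: sgn_char_def)
qed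

lemma indicator_norm_group: "indicator (norm_group \<theta>) x = 1 / 2 * (1 + sgn_char \<theta> x)"
  by (simp add: sgn_char_def)

lemma tame_indicator_norm_group:
  assumes "residual_char_not_2 TYPE('a::nonarch_local_field)"
  shows "tame (indicator (norm_group (\<theta> :: 'a)))"
  unfolding indicator_norm_group[abs_def]
  by (intro tame_mult tame_add tame_const tame_sgn_char assms)

section \<open>Vanishing of Bessel shells and linearity in the multiplicative weight\<close>

context
  fixes \<mu> :: "'a::nonarch_local_field measure" and \<Psi> :: "'a \<Rightarrow> complex" and u v :: 'a and a b :: int
  assumes haar: "normalised_haar \<mu>"
    and \<Psi>: "additive_character \<Psi>"
    and trivial: "\<And>x. x \<in> val_ring \<Longrightarrow> \<Psi> x = 1"
    and nontrivial: "\<exists>x\<in>ppow (- 1). \<Psi> x \<noteq> 1"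
    and u: "u \<in> shell a" and v: "v \<in> shell b"
begin

lemma bessel_char_perturb: "x - y \<in> val_ring \<Longrightarrow> \<Psi> x = \<Psi> y"
  by (rule additive_character_perturb[OF \<Psi>]) (rule trivial)

lemma inverse_perturb:
  assumes x: "x \<in> shell n" and y: "y \<in> ppow m" and m: "n < m"
  shows "v * inverse (x + y) - v * inverse x \<in> ppow (b + m - 2 * n)"
proof -
  have xy: "x + y \<in> shell n" by (rule shell_add_le[OF x y m])
  have "v * inverse (x + y) - v * inverse x = - (v * y * inverse x * inverse (x + y))"
    using shell_nonzero[OF x] shell_nonzero[OF xy] by (simp add: field_simps)
  moreover have "v * y * inverse x * inverse (x + y) \<in> ppow (b + m + - n + - n)"
    by (intro ppow_mult shell_subset_ppow[OF v] y shell_subset_ppow shell_inverse x xy)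
  ultimately show ?thesis by simp
qed

text \<open>The three bounds protect, in turn, the weight (and the shell), the term
  \<open>u * x\<close>, and the term \<open>v * inverse x\<close>, whose change has valuation at
  least b + m - 2n under a shift from p^m.\<close>

lemma bessel_integrand_perturb:
  assumes \<kappa>: "tame \<kappa>" and x: "x \<in> shell n" and y: "y \<in> ppow (max (n + 1) (max (- a) (2 * n - b)))"
  shows "\<Psi> (u * (x + y) + v * inverse (x + y)) * \<kappa> (x + y) = \<Psi> (u * x + v * inverse x) * \<kappa> x"
proof -
  have "u * y \<in> val_ring"
    using shell_subset_ppow[OF u] y by (rule ppow_mult_le) simp
  moreover have "v * inverse (x + y) - v * inverse x \<in> val_ring"
    using inverse_perturb[OF x y] by (rule ppow_mono) auto
  ultimately have "u * y + (v * inverse (x + y) - v * inverse x) \<in> val_ring"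
    by (rule ppow_add)
  then have "\<Psi> (u * (x + y) + v * inverse (x + y)) = \<Psi> (u * x + v * inverse x)"
    by (intro bessel_char_perturb) (simp add: algebra_simps)
  moreover have "y \<in> ppow (n + 1)"
    using y by (rule ppow_mono) simp
  ultimately show ?thesis
    using tame_perturb[OF \<kappa> x] by simp
qed

lemma bessel_integrand_bound:
  assumes "tame \<kappa>"
  obtains B where "\<And>x. x \<in> shell n \<Longrightarrow> norm (\<Psi> (u * x + v * inverse x) * \<kappa> x) \<le> B"
  using tame_bound[OF assms, of n] norm_additive_character[OF \<Psi>] by (metis mult_1 norm_mult)

lemma sum_bessel_character:
  assumes "c \<in> shell (- 1)"
  shows "(\<Sum>x\<in>residue_reps. \<Psi> (c * x)) = 0"
  by (rule sum_character_scaled_reps[OF \<Psi> _ nontrivial assms]) (simp add: trivial)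

text \<open>In each of the two ranges one of \<open>u * x\<close> and \<open>v * inverse x\<close>
  is integral while the other has valuation at most -2. A suitable translation leaves the former
  irrelevant and changes the latter, modulo integral terms, by a non-trivial character of the
  residue field.\<close>

lemma bessel_integral_eq_0:
  assumes \<kappa>: "tame \<kappa>" and n: "n \<le> b \<and> n + a \<le> - 2 \<or> - a \<le> n \<and> b + 2 \<le> n"
  shows "(LINT x:shell n|\<mu>. \<Psi> (u * x + v * inverse x) * \<kappa> x) = 0"
proof -
  \<comment> \<open>Chosen so that the first-order change has valuation -1: \<open>u * c\<close> in
    the first range, v c / x^2 in the second. The bounds -2 and b + 2 ensure that this shift still
    lies in p^(n+1).\<close>
  define m where "m = (if n \<le> b \<and> n + a \<le> - 2 then - 1 - a else 2 * n - b - 1)"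
  have m: "n + 1 \<le> m" using n by (auto simp: m_def)
  obtain c :: 'a where c: "c \<in> shell m" by (rule shell_nonempty)
  obtain B where B: "\<And>x. x \<in> shell n \<Longrightarrow> norm (\<Psi> (u * x + v * inverse x) * \<kappa> x) \<le> B"
    using bessel_integrand_bound[OF \<kappa>] by blast
  show ?thesis
  proof (rule shell_integral_eq_0_by_averaging[OF haar bessel_integrand_perturb[OF \<kappa>] B])
    show "c \<in> ppow (n + 1)"
      using shell_subset_ppow[OF c] m by (rule ppow_mono)
    fix x :: 'a assume x: "x \<in> shell n"
    obtain d where d: "d \<in> shell (- 1)"
      and pert: "\<And>y. y \<in> val_ring \<Longrightarrow>
        \<Psi> (u * (x + c * y) + v * inverse (x + c * y)) = \<Psi> (u * x + v * inverse x) * \<Psi> (d * y)"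
    proof (cases "n \<le> b \<and> n + a \<le> - 2")
      case True
      then have mm: "m = - 1 - a" by (simp add: m_def)
      show thesis
      proof (rule that)
        show "u * c \<in> shell (- 1)"
          using shell_mult[OF u c] by (simp add: mm)
        fix y :: 'a assume y: "y \<in> val_ring"
        have cy: "c * y \<in> ppow m"
          using ppow_mult[OF shell_subset_ppow[OF c] y] by simp
        have "v * inverse (x + c * y) - v * inverse x \<in> val_ring"
          using inverse_perturb[OF x cy] m True by (auto elim: ppow_mono)
        then have "\<Psi> (u * (x + c * y) + v * inverse (x + c * y)) = \<Psi> (u * x + v * inverse x + u * c * y)"
          by (intro bessel_char_perturb) (simp add: algebra_simps)
        then show "\<Psi> (u * (x + c * y) + v * inverse (x + c * y)) =
            \<Psi> (u * x + v * inverse x) * \<Psi> (u * c * y)"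
          by (simp add: additive_character_add[OF \<Psi>])
      qed
    next
      case False
      then have mm: "m = 2 * n - b - 1" and n': "- a \<le> n" "b + 2 \<le> n" using n by (auto simp: m_def)
      \<comment> \<open>The derivative of v/x times \<open>c\<close>. The second-order remainder has
        valuation at least b + 2m - 3n = n - b - 2, which is non-negative by the choice of
        range.\<close>
      define d where "d = - (v * c * inverse x * inverse x)"
      have "v * c * inverse x * inverse x \<in> shell (b + m + - n + - n)"
        by (intro shell_mult v c shell_inverse x)
      then have d: "d \<in> shell (- 1)"
        by (simp add: d_def mm)
      show thesis
      proof (rule that[OF d])
        fix y :: 'a assume y: "y \<in> val_ring"
        have cy: "c * y \<in> ppow m"
          using ppow_mult[OF shell_subset_ppow[OF c] y] by simp
        have xy: "x + c * y \<in> shell n"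
          using m by (intro shell_add_le[OF x cy]) simp
        have 1: "u * (c * y) \<in> val_ring"
          using shell_subset_ppow[OF u] cy by (rule ppow_mult_le) (use n' mm in simp)
        have "v * ((c * y) * (c * y)) * inverse x * inverse x * inverse (x + c * y)
            \<in> ppow (b + (m + m) + - n + - n + - n)"
          by (intro ppow_mult shell_subset_ppow[OF v] cy shell_subset_ppow shell_inverse x xy)
        moreover have "b + (m + m) + - n + - n + - n \<ge> 0"
          using n' mm by simp
        moreover have "v * inverse (x + c * y) - v * inverse x - d * y =
            v * ((c * y) * (c * y)) * inverse x * inverse x * inverse (x + c * y)"
          using shell_nonzero[OF x] shell_nonzero[OF xy]
          by (simp add: d_def divide_simps) (simp add: algebra_simps)
        ultimately have 2: "v * inverse (x + c * y) - v * inverse x - d * y \<in> val_ring"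
          by (auto elim: ppow_mono)
        have "\<Psi> (u * (x + c * y) + v * inverse (x + c * y)) = \<Psi> (u * x + v * inverse x + d * y)"
          using ppow_add[OF 1 2] by (intro bessel_char_perturb) (simp add: algebra_simps)
        then show "\<Psi> (u * (x + c * y) + v * inverse (x + c * y)) =
            \<Psi> (u * x + v * inverse x) * \<Psi> (d * y)"
          by (simp add: additive_character_add[OF \<Psi>])
      qed
    qed
    have "\<kappa> (x + c * y) = \<kappa> x" if "y \<in> val_ring" for y
    proof (rule tame_perturb[OF \<kappa> x])
      show "c * y \<in> ppow (n + 1)"
        using shell_subset_ppow[OF c] that by (rule ppow_mult_le) (use m in simp)
    qed
    then have "(\<Sum>y\<in>residue_reps. \<Psi> (u * (x + c * y) + v * inverse (x + c * y)) * \<kappa> (x + c * y)) =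
        \<Psi> (u * x + v * inverse x) * \<kappa> x * (\<Sum>y\<in>residue_reps. \<Psi> (d * y))"
      unfolding sum_distrib_left by (intro sum.cong refl) (simp add: pert residue_reps_val_ring)
    then show "(\<Sum>y\<in>residue_reps. \<Psi> (u * (x + c * y) + v * inverse (x + c * y)) * \<kappa> (x + c * y)) = 0"
      by (simp add: sum_bessel_character[OF d])
  qed
qed

definition bessel_term :: "('a \<Rightarrow> complex) \<Rightarrow> int \<Rightarrow> complex" where
  "bessel_term \<kappa> n = (LINT x:shell n|mult_haar \<mu>. \<Psi> (u * x + v * inverse x) * \<kappa> x)"

lemma bessel_eq_infsum: "bessel \<mu> \<Psi> \<kappa> u v = (\<Sum>\<^sub>\<infinity>n. bessel_term \<kappa> n)"
  by (simp add: bessel_def bessel_term_def)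

lemma bessel_term_eq:
  assumes "tame \<kappa>"
  shows "bessel_term \<kappa> n =
    of_real (residue_q TYPE('a) powi n) * (LINT x:shell n|\<mu>. \<Psi> (u * x + v * inverse x) * \<kappa> x)"
  unfolding bessel_term_def
  by (rule mult_haar_shell_integral[OF haar]) (rule bessel_integrand_perturb[OF assms])

text \<open>Below the interval \<open>u * x\<close> oscillates, above it
  \<open>v * inverse x\<close> does; the support in \<open>n\<close> is finite. This is what permits
  adding the sums over shells termwise.\<close>

lemma bessel_term_summable:
  assumes "tame \<kappa>"
  shows "bessel_term \<kappa> summable_on UNIV"
proof -
  let ?S = "{min b (- a - 2)..max (- a) (b + 2)}"
  have "bessel_term \<kappa> n = 0" if "n \<notin> ?S" for n
    using that bessel_integral_eq_0[OF assms, of n] by (simp add: bessel_term_eq[OF assms]) linarith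
  then have "bessel_term \<kappa> summable_on UNIV \<longleftrightarrow> bessel_term \<kappa> summable_on ?S"
    by (intro summable_on_cong_neutral) auto
  then show ?thesis by simp
qed

lemma bessel_add:
  assumes "tame \<kappa>" "tame \<eta>"
  shows "bessel \<mu> \<Psi> (\<lambda>x. \<kappa> x + \<eta> x) u v = bessel \<mu> \<Psi> \<kappa> u v + bessel \<mu> \<Psi> \<eta> u v"
proof -
  have int: "set_integrable \<mu> (shell n) (\<lambda>x. \<Psi> (u * x + v * inverse x) * \<kappa> x)" if \<kappa>: "tame \<kappa>" for \<kappa> n
  proof -
    obtain B where B: "\<And>x. x \<in> shell n \<Longrightarrow> norm (\<Psi> (u * x + v * inverse x) * \<kappa> x) \<le> B"
      using bessel_integrand_bound[OF \<kappa>] by blast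
    show ?thesis
      by (rule set_integrable_shell[OF haar _ B]) (rule bessel_integrand_perturb[OF \<kappa>])
  qed
  have "bessel_term (\<lambda>x. \<kappa> x + \<eta> x) n = bessel_term \<kappa> n + bessel_term \<eta> n" for n
    unfolding bessel_term_eq[OF tame_add[OF assms]] bessel_term_eq[OF assms(1)] bessel_term_eq[OF assms(2)]
    using set_integral_add(2)[OF int[OF assms(1)] int[OF assms(2)]]
    by (simp add: distrib_left)
  then show ?thesis
    by (simp add: bessel_eq_infsum infsum_add bessel_term_summable assms)
qed

lemma bessel_cmult: "bessel \<mu> \<Psi> (\<lambda>x. c * \<kappa> x) u v = c * bessel \<mu> \<Psi> \<kappa> u v"
proof -
  have "bessel_term (\<lambda>x. c * \<kappa> x) n = c * bessel_term \<kappa> n" for n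
    unfolding bessel_term_def set_integral_mult_right[symmetric] by (simp add: mult.left_commute)
  then show ?thesis
    by (simp add: bessel_eq_infsum infsum_cmult_right')
qed

text \<open>The averaging in the definition is the restriction of the integral to norms; in this
  form it matches the indicator in the mock Fourier transform.\<close>

lemma bessel_theta_eq:
  assumes "residual_char_not_2 TYPE('a)" "tame \<kappa>"
  shows "bessel_theta \<mu> \<Psi> \<theta> \<kappa> u v = bessel \<mu> \<Psi> (\<lambda>x. indicator (norm_group \<theta>) x * \<kappa> x) u v"
proof -
  have "(\<lambda>x. indicator (norm_group \<theta>) x * \<kappa> x) = (\<lambda>x. 1 / 2 * (\<kappa> x + \<kappa> x * sgn_char \<theta> x))"
    unfolding indicator_norm_group by (simp add: field_simps)
  then show ?thesis
    unfolding bessel_theta_def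
    by (simp only: bessel_cmult bessel_add[OF assms(2) tame_mult[OF assms(2) tame_sgn_char[OF assms(1)]]])
qed

end

text \<open>Shells omit 0, so an identity for non-zero \<open>x\<close> suffices; it is the entry
  point for replacing the inner integral pointwise.\<close>

lemma bessel_cong:
  fixes \<mu> :: "'a::nonarch_local_field measure"
  assumes "normalised_haar \<mu>"
    and "\<And>x. x \<noteq> 0 \<Longrightarrow> F x = \<Psi> (u * x + v * inverse x) * \<kappa> x"
  shows "(\<Sum>\<^sub>\<infinity>n. LINT x:shell n|mult_haar \<mu>. F x) = bessel \<mu> \<Psi> \<kappa> u v"
proof -
  have "(LINT x:shell n|mult_haar \<mu>. F x) =
      (LINT x:shell n|mult_haar \<mu>. \<Psi> (u * x + v * inverse x) * \<kappa> x)" for n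
    by (rule set_lebesgue_integral_cong)
      (auto simp: mult_haar_def open_in_sets_haar[OF assms(1)] open_shell shell_nonzero assms(2))
  then show ?thesis by (simp add: bessel_def)
qed

section \<open>Evaluation of the mock Fourier transform\<close>

theorem proposition8p5:
  fixes \<mu> :: "'k::nonarch_local_field measure"
    and \<Phi> \<Phi>' \<Psi> :: "'k \<Rightarrow> complex"
    and \<epsilon> \<pi> \<beta> \<theta> s \<theta>' u v :: 'k
    and X :: "'k ^ 2 ^ 2 \<Rightarrow> 'k"
    and Y :: "'k ^ 2 ^ 2"
    and r' :: int
    and q :: real
  assumes "residual_char_not_2 TYPE('k)"
    and "normalised_haar \<mu>"
    and "lifts_nonsquare \<epsilon>"
    and "uniformiser \<pi>"
    and "nontrivial_additive_character \<Phi>"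
    and "\<beta> \<noteq> 0" "\<theta> \<noteq> 0" "s \<noteq> 0" "\<theta>' \<noteq> 0"
    and "X = trace_functional (mat \<beta> ** sqrt_mat \<theta>)"
    and "Y = mat s ** sqrt_mat \<theta>'"
    and "q = real (residue_card TYPE('k))"
    and "\<Phi>' = scale_char \<Phi> \<beta>"
    and "r' = depth \<Phi>'"
    and "\<Psi> = scale_char \<Phi>' (\<pi> powi (r' + 1))"
    and "u = \<pi> powi (- (r' + 1)) * s * \<theta>'"
    and "v = \<pi> powi (- (r' + 1)) * s * \<theta>"
  shows "mock_FT \<mu> \<Phi> X Y =
    1 / 2 * of_real (absv s powr (- 1 / 2)) * of_real (q powr (- (of_int r' + 1) / 2)) *
    ((bessel_theta \<mu> \<Psi> \<theta> (nu (1 / 2)) u v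
      + gamma_un \<Phi>' \<epsilon> s * bessel_theta \<mu> \<Psi> \<theta> (\<lambda>x. nu (1 / 2) x * sgn_char \<epsilon> x) u v)
     + gamma_ram \<Phi>' \<pi> s *
       (bessel_theta \<mu> \<Psi> \<theta> (\<lambda>x. nu (1 / 2) x * sgn_char \<pi> x) u v
        - gamma_un \<Phi>' \<epsilon> s *
          bessel_theta \<mu> \<Psi> \<theta> (\<lambda>x. nu (1 / 2) x * sgn_char (\<epsilon> * \<pi>) x) u v))"
proof -
  note char = assms(1) and haar = assms(2) and \<epsilon> = assms(3) and \<pi> = assms(4)
    and nz = assms(6-9) and q = assms(12) and \<Phi>' = assms(13) and r' = assms(14)
    and \<Psi> = assms(15) and u = assms(16) and v = assms(17)
  have \<pi>0: "\<pi> \<noteq> 0" "vord \<pi> = 1" using \<pi> by (auto simp: uniformiser_def)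
  have q1: "1 < q" using residue_q_gt_1[where ?'a = 'k] by (simp add: q)
  \<comment> \<open>The scaling that moves the depth of \<open>\<Phi>'\<close> to -1; it cancels the
    power of the uniformiser in \<open>u\<close> and \<open>v\<close>.\<close>
  define P where "P = \<pi> powi (r' + 1)"
  have P: "P \<in> shell (r' + 1)" "P \<noteq> 0"
    using \<pi>0 by (auto simp: P_def shell_def vord_powi)
  have Pinv: "\<pi> powi (- (r' + 1)) = inverse P"
    unfolding P_def by (rule power_int_minus)
  have \<Phi>'nt: "nontrivial_additive_character \<Phi>'"
    unfolding \<Phi>' by (rule nontrivial_scale_char[OF assms(5) nz(1)])
  then have \<Phi>'c: "additive_character \<Phi>'"
    by (simp add: nontrivial_additive_character_def)
  have \<Psi>P: "\<Psi> x = \<Phi>' (P * x)" for x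
    by (simp add: \<Psi> scale_char_def P_def)
  have \<Psi>c: "additive_character \<Psi>"
    using nontrivial_scale_char[OF \<Phi>'nt P(2)] by (simp add: \<Psi> P_def nontrivial_additive_character_def)
  have triv: "\<Psi> x = 1" if "x \<in> val_ring" for x
    unfolding \<Psi>P using ppow_mult[OF shell_subset_ppow[OF P(1)] that] trivial_above_depth[OF \<Phi>'nt]
    by (simp add: r')
  have nontriv: "\<exists>x\<in>ppow (- 1). \<Psi> x \<noteq> 1"
  proof -
    obtain x where x: "x \<in> ppow r'" "\<Phi>' x \<noteq> 1"
      using nontrivial_at_depth[OF \<Phi>'nt] by (auto simp: r')
    have "x / P \<in> ppow (- 1)"
      using ppow_div_shell[OF P(1) x(1)] by simp
    moreover have "\<Psi> (x / P) \<noteq> 1"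
      using x(2) P(2) by (simp add: \<Psi>P)
    ultimately show ?thesis by blast
  qed
  have "u \<noteq> 0" "v \<noteq> 0" using nz \<pi>0 by (simp_all add: u v)
  then have uv: "u \<in> shell (vord u)" "v \<in> shell (vord v)"
    by (simp_all add: in_shell_vord)
  note ctx = haar \<Psi>c triv nontriv uv
  define C :: complex where "C = of_real (absv s powr (- 1 / 2)) * of_real (q powr (- (of_int r' + 1) / 2))"
  define \<gamma>\<^sub>1 \<gamma>\<^sub>2 where "\<gamma>\<^sub>1 = gamma_un \<Phi>' \<epsilon> s" and "\<gamma>\<^sub>2 = gamma_ram \<Phi>' \<pi> s"
  define N :: "'k \<Rightarrow> complex" where "N = indicator (norm_group \<theta>)"
  \<comment> \<open>The outer weight left over once the inner integral is evaluated at a = -s/x,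
    whose valuation is ord s - ord x.\<close>
  define K where "K = (\<lambda>x. C * (N x * (nu (1 / 2) x *
      (if even (r' - (vord s - vord x)) then \<gamma>\<^sub>2 * sgn_char \<pi> x else 1))))"
  have inner: "N x * (\<Sum>\<^sub>\<infinity>l. LINT t:shell l|\<mu>. \<Phi> (\<beta> * s * (x * \<theta>' + inverse x * \<theta> - inverse x * t\<^sup>2))) =
      \<Psi> (u * x + v * inverse x) * K x" if x: "x \<noteq> 0" for x
  proof -
    define a where "a = - s * inverse x"
    have a: "a \<in> shell (vord s - vord x)"
      using x nz by (simp add: a_def shell_def vord_mult vord_inverse)
    have "\<Phi> (\<beta> * s * (x * \<theta>' + inverse x * \<theta> - inverse x * t\<^sup>2)) =
        \<Psi> (u * x + v * inverse x) * \<Phi>' (a * t\<^sup>2)" for t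
    proof -
      have "\<Psi> (u * x + v * inverse x) * \<Phi>' (a * t\<^sup>2) = \<Phi>' (P * (u * x + v * inverse x) + a * t\<^sup>2)"
        by (simp only: \<Psi>P additive_character_add[OF \<Phi>'c])
      also have "P * (u * x + v * inverse x) + a * t\<^sup>2 =
          s * (x * \<theta>' + inverse x * \<theta> - inverse x * t\<^sup>2)"
        unfolding u v Pinv a_def using P(2) by (simp add: field_simps)
      finally show ?thesis
        by (simp add: \<Phi>' scale_char_def mult.assoc)
    qed
    then have "(\<Sum>\<^sub>\<infinity>l. LINT t:shell l|\<mu>. \<Phi> (\<beta> * s * (x * \<theta>' + inverse x * \<theta> - inverse x * t\<^sup>2))) =
        \<Psi> (u * x + v * inverse x) * (\<Sum>\<^sub>\<infinity>l. LINT t:shell l|\<mu>. \<Phi>' (a * t\<^sup>2))"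
      by (simp add: infsum_cmult_right')
    also have "(\<Sum>\<^sub>\<infinity>l. LINT t:shell l|\<mu>. \<Phi>' (a * t\<^sup>2)) =
        of_real (q powr (- (of_int r' + 1 - of_int (vord s - vord x)) / 2)) *
        (if even (r' - (vord s - vord x)) then sgn_char \<pi> a * gauss_sum \<pi> \<Phi>' else 1)"
      unfolding q by (rule quadratic_gauss_integral[OF char \<Phi>'nt r' haar \<pi> a])
    also have "complex_of_real (q powr (- (of_int r' + 1 - of_int (vord s - vord x)) / 2)) = C * nu (1 / 2) x"
    proof -
      \<comment> \<open>Writing all factors as powers of q turns the identity into additivity of
        exponents: ord s / 2, -(r'+1)/2 and -ord x / 2.\<close>
      have "absv z powr e = q powr (- of_int (vord z) * e)" if "z \<noteq> 0" for z :: 'k and e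
        using q1 that powr_real_of_int'[of q "- vord z"] powr_powr[of q "- of_int (vord z)" e]
        by (simp add: absv_def flip: q)
      moreover have "- (of_int r' + 1 - of_int (vord s - vord x)) / 2 =
          - of_int (vord s) * (- 1 / 2) + - (of_int r' + 1) / 2 + - of_int (vord x) * (1 / 2 :: real)"
        by (simp add: field_simps)
      ultimately show ?thesis
        using x nz by (simp only: C_def nu_def of_real_mult powr_add) simp
    qed
    also have "sgn_char \<pi> a * gauss_sum \<pi> \<Phi>' = \<gamma>\<^sub>2 * sgn_char \<pi> x"
    proof -
      \<comment> \<open>The sign character does not see squares, so the inverse of \<open>x\<close>
        may be replaced by \<open>x\<close>.\<close>
      have "a = (- s * x) * (inverse x)\<^sup>2"
        using x by (simp add: a_def power2_eq_square)
      then have "sgn_char \<pi> a = sgn_char \<pi> (- s * x)"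
        using x sgn_char_mult_power2[of "inverse x" \<pi> "- s * x"] by simp
      also have "\<dots> = sgn_char \<pi> (- s) * sgn_char \<pi> x"
        using sgn_char_uniformiser_mult[OF char \<pi>, of "- s" x] nz x by simp
      finally show ?thesis by (simp add: \<gamma>\<^sub>2_def gamma_ram_def)
    qed
    finally show ?thesis by (simp add: K_def mult_ac)
  qed
  have "mock_FT \<mu> \<Phi> X Y = mock_FT_integral \<mu> \<Phi> \<beta> \<theta> s \<theta>'"
    unfolding assms(10,11) by (rule mock_FT_eq[OF nz])
  also have "\<dots> = bessel \<mu> \<Psi> K u v"
    unfolding mock_FT_integral_def N_def[symmetric] by (rule bessel_cong[OF haar]) (rule inner)
  \<comment> \<open>The weight \<open>K\<close> with its parity condition replaced by the two
    projectors. The difference is written with the scalar \<open>- \<gamma>\<^sub>1\<close> so that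
    linearity needs only sums and scalar multiples.\<close>
  also have "\<dots> = bessel \<mu> \<Psi> (\<lambda>x. 1 / 2 * C * ((N x * nu (1 / 2) x + \<gamma>\<^sub>1 * (N x * (nu (1 / 2) x * sgn_char \<epsilon> x))) +
      \<gamma>\<^sub>2 * (N x * (nu (1 / 2) x * sgn_char \<pi> x) +
        (- \<gamma>\<^sub>1) * (N x * (nu (1 / 2) x * sgn_char (\<epsilon> * \<pi>) x))))) u v"
    unfolding bessel_def
  proof (rule bessel_cong[OF haar, unfolded bessel_def])
    fix x :: 'k assume x: "x \<noteq> 0"
    have "(- 1 :: complex) powi (r' + 1) = (if even r' then - 1 else 1)"
      by (simp add: power_int_minus_left)
    \<comment> \<open>The parities of r' + 1, ord s and ord x combine to that of r' - ord a, shifted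
      by one. Hence (1 + sign)/2 keeps the shells without a Gauss sum and (1 - sign)/2 those with
      one.\<close>
    then have sign: "\<gamma>\<^sub>1 * sgn_char \<epsilon> x = (if even (r' - (vord s - vord x)) then - 1 else 1)"
      using sgn_char_unramified[OF char \<epsilon> x] sgn_char_unramified[OF char \<epsilon> nz(3)]
      by (auto simp: \<gamma>\<^sub>1_def gamma_un_def r'[symmetric])
    have "1 / 2 * C * ((N x * nu (1 / 2) x + \<gamma>\<^sub>1 * (N x * (nu (1 / 2) x * sgn_char \<epsilon> x))) +
        \<gamma>\<^sub>2 * (N x * (nu (1 / 2) x * sgn_char \<pi> x) +
          (- \<gamma>\<^sub>1) * (N x * (nu (1 / 2) x * sgn_char (\<epsilon> * \<pi>) x)))) =
        C * (N x * (nu (1 / 2) x * (1 / 2 * (1 + \<gamma>\<^sub>1 * sgn_char \<epsilon> x) +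
          1 / 2 * (1 - \<gamma>\<^sub>1 * sgn_char \<epsilon> x) * (\<gamma>\<^sub>2 * sgn_char \<pi> x))))"
      unfolding sgn_char_unramified_mult_uniformiser[OF char \<epsilon> \<pi> x] by (simp add: algebra_simps)
    also have "\<dots> = K x"
      unfolding sign K_def by (cases "even (r' - (vord s - vord x))") (simp_all only: if_True if_False, simp_all)
    finally show "\<Psi> (u * x + v * inverse x) * K x = \<Psi> (u * x + v * inverse x) * (1 / 2 * C *
      ((N x * nu (1 / 2) x + \<gamma>\<^sub>1 * (N x * (nu (1 / 2) x * sgn_char \<epsilon> x))) +
      \<gamma>\<^sub>2 * (N x * (nu (1 / 2) x * sgn_char \<pi> x) +
        (- \<gamma>\<^sub>1) * (N x * (nu (1 / 2) x * sgn_char (\<epsilon> * \<pi>) x)))))"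
      by simp
  qed
  \<comment> \<open>Every weight in the expansion is tame, so the Bessel function may be split
    termwise; the indicator of the norms is then absorbed into each
    \<open>bessel_theta\<close>.\<close>
  also have "\<dots> = 1 / 2 * C * ((bessel_theta \<mu> \<Psi> \<theta> (nu (1 / 2)) u v
      + \<gamma>\<^sub>1 * bessel_theta \<mu> \<Psi> \<theta> (\<lambda>x. nu (1 / 2) x * sgn_char \<epsilon> x) u v)
     + \<gamma>\<^sub>2 * (bessel_theta \<mu> \<Psi> \<theta> (\<lambda>x. nu (1 / 2) x * sgn_char \<pi> x) u v
        + (- \<gamma>\<^sub>1) * bessel_theta \<mu> \<Psi> \<theta> (\<lambda>x. nu (1 / 2) x * sgn_char (\<epsilon> * \<pi>) x) u v))"
    unfolding N_def
    by (simp only: bessel_cmult[OF ctx] bessel_add[OF ctx] bessel_theta_eq[OF ctx char]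
        tame_add tame_mult tame_const tame_nu tame_sgn_char[OF char] tame_indicator_norm_group[OF char])
  finally show ?thesis
    unfolding C_def \<gamma>\<^sub>1_def \<gamma>\<^sub>2_def by (simp add: mult.assoc)
qed

end
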